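(* Let $\mathbf k=(k_2,k_3,k_4,k_5)$ be the selected signed witness profile (defined in the context for all sufficiently large $n$), with $u_i=\alpha-i$, and for integer vectors $\ell=(\ell_2,\ell_3,\ell_4,\ell_5)$ with $0\le\ell_i\le k_i$ put $$D(\ell):=\frac{\prod_i\binom{k_i}{\ell_i}^2}{Y_\ell^{\mathrm{sgn}}},\qquad Y_\ell^{\mathrm{sgn}}:=2^{\ell_\bullet}\frac{n!}{(n-m)!\prod_i(u_i!)^{\ell_i}\ell_i!}2^{-b_\ell},$$ where $\ell_\bullet=\sum_i\ell_i$, $m=\sum_iu_i\ell_i$, $b_\ell=\sum_i\binom{u_i}2\ell_i$. Then, uniformly over the complete phase, $$\sum_{0\le\ell_i\le k_i}D(\ell)=1+o(1)\qquad(n\to\infty),$$ where the error is bounded by one deterministic sequence tending to zero.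
   Context: Logarithms are natural unless a base is shown. Put $\alpha_0(n):=2\log_2 n-2\log_2\log_2 n+2\log_2(\mathrm e/2)+1$, $\alpha:=\lfloor\alpha_0(n)\rfloor$, $s_0:=\alpha_0(n)-1-\frac2{\log 2}$, $d_u:=2^{\binom u2}u!$. The phase is $\delta_n=\alpha_0(n)-\alpha$; "uniformly over the phase" means the error sequence and the threshold on $n$ do not depend on the position of $\delta_n$ in $[0,1)$ (the result is along the full sequence of integers $n$). Selected signed witness profile. For real $k>0$ let $L_{S_4}(n,k)$ be the maximum of $n\log n-n+k-\sum_{i=2}^5x_i\log(x_id_{\alpha-i})$ over reals $x_i\ge0$ with $\sum_{i=2}^5x_i=k$, $\sum_{i=2}^5(\alpha-i)x_i=n$ (when this set is nonempty; $0\log0=0$). There is an absolute constant $A_*>0$ such that for all sufficiently large $n$ the equation $L_{S_4}(n,k)+(\log2)k=0$ has a unique feasible solution $k=r_4^{\mathrm{co}}$ with $|n/k-s_0|\le A_*\log\log n/\log n$; fix such $A_*$. Put $k_{\mathrm{co}}:=\lceil r_4^{\mathrm{co}}\rceil+16$, and let $(x_i^* )_{2\le i\le5}$ be the maximizer defining $L_{S_4}(n,k_{\mathrm{co}})$. Choose integers $\widetilde k_i$ with $|\widetilde k_i-x_i^*|\le1$, set $e_0=\sum_i\widetilde k_i-k_{\mathrm{co}}$, $e_1=\sum_ii\widetilde k_i-(\alpha k_{\mathrm{co}}-n)$, and define $k_2=\widetilde k_2+e_1-3e_0$, $k_3=\widetilde k_3+2e_0-e_1$, $k_4=\widetilde k_4$,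 $k_5=\widetilde k_5$. For large $n$ these are positive integers with $\sum_ik_i=k_{\mathrm{co}}$ and $\sum_i(\alpha-i)k_i=n$; $k_i$ is the number of classes of size $u_i=\alpha-i$. *)

theory Defs
  imports "HOL-Analysis.Analysis"
begin

definition alpha0 :: "nat \<Rightarrow> real" where
  "alpha0 n = 2 * log 2 (real n) - 2 * log 2 (log 2 (real n)) + 2 * log 2 (exp 1 / 2) + 1"

definition alpha :: "nat \<Rightarrow> int" where
  "alpha n = \<lfloor>alpha0 n\<rfloor>"

definition s0 :: "nat \<Rightarrow> real" where
  "s0 n = alpha0 n - 1 - 2 / ln 2"

text \<open>The truncation in \<open>nat\<close> below is harmless: all statements concern large \<open>n\<close>, where
  \<open>alpha n\<close> exceeds 5, and \<open>i\<close> only ranges over \<open>{2..5}\<close>.\<close>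

definition class_size :: "nat \<Rightarrow> nat \<Rightarrow> nat" where
  "class_size n i = nat (alpha n - int i)"

definition d :: "nat \<Rightarrow> real" where
  "d u = 2 ^ (u choose 2) * fact u"

text \<open>Vectors indexed by \<open>2 \<le> i \<le> 5\<close> are extensional functions on \<open>{2..5}\<close>, so that a
  maximizer can be unique as a function.\<close>

definition feasible :: "nat \<Rightarrow> real \<Rightarrow> (nat \<Rightarrow> real) set" where
  "feasible n k = {x \<in> {2..5} \<rightarrow>\<^sub>E {0..}.
     (\<Sum>i=2..5. x i) = k \<and> (\<Sum>i=2..5. real (class_size n i) * x i) = real n}"

text \<open>The convention \<open>0 * ln 0 = 0\<close> holds automatically.\<close>

definition objective :: "nat \<Rightarrow> real \<Rightarrow> (nat \<Rightarrow> real) \<Rightarrow> real" where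
  "objective n k x =
     real n * ln (real n) - real n + k - (\<Sum>i=2..5. x i * ln (x i * d (class_size n i)))"

definition L_S4 :: "nat \<Rightarrow> real \<Rightarrow> real" where
  "L_S4 n k = (GREATEST v. v \<in> objective n k ` feasible n k)"

definition maximizer :: "nat \<Rightarrow> real \<Rightarrow> nat \<Rightarrow> real" where
  "maximizer n k = (ARG_MAX (objective n k) x. x \<in> feasible n k)"

definition is_co_root :: "real \<Rightarrow> nat \<Rightarrow> real \<Rightarrow> bool" where
  "is_co_root A n k \<longleftrightarrow> k > 0 \<and> feasible n k \<noteq> {} \<and> L_S4 n k + ln 2 * k = 0 \<and>
     \<bar>real n / k - s0 n\<bar> \<le> A * ln (ln (real n)) / ln (real n)"

definition admissible_window :: "real \<Rightarrow> bool" where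
  "admissible_window A \<longleftrightarrow> A > 0 \<and> (\<forall>\<^sub>F n in sequentially. \<exists>!k. is_co_root A n k)"

definition co_root :: "real \<Rightarrow> nat \<Rightarrow> real" where
  "co_root A n = (THE k. is_co_root A n k)"

definition k_co :: "real \<Rightarrow> nat \<Rightarrow> int" where
  "k_co A n = \<lceil>co_root A n\<rceil> + 16"

definition is_rounding :: "real \<Rightarrow> nat \<Rightarrow> (nat \<Rightarrow> int) \<Rightarrow> bool" where
  "is_rounding A n kt \<longleftrightarrow>
     (\<forall>i\<in>{2..5}. \<bar>real_of_int (kt i) - maximizer n (real_of_int (k_co A n)) i\<bar> \<le> 1)"

definition e0 :: "real \<Rightarrow> nat \<Rightarrow> (nat \<Rightarrow> int) \<Rightarrow> int" where
  "e0 A n kt = (\<Sum>i=2..5. kt i) - k_co A n"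

definition e1 :: "real \<Rightarrow> nat \<Rightarrow> (nat \<Rightarrow> int) \<Rightarrow> int" where
  "e1 A n kt = (\<Sum>i=2..5. int i * kt i) - (alpha n * k_co A n - int n)"

text \<open>The repaired entries are positive integers for all large \<open>n\<close>, so \<open>nat\<close> does not
  truncate there.\<close>

definition profile :: "real \<Rightarrow> nat \<Rightarrow> (nat \<Rightarrow> int) \<Rightarrow> nat \<Rightarrow> nat" where
  "profile A n kt i = nat (
     if i = 2 then kt 2 + e1 A n kt - 3 * e0 A n kt
     else if i = 3 then kt 3 + 2 * e0 A n kt - e1 A n kt
     else kt i)"

definition Y_sgn :: "nat \<Rightarrow> (nat \<Rightarrow> nat) \<Rightarrow> real" where
  "Y_sgn n l =
     (let m = (\<Sum>i=2..5. class_size n i * l i);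
          b = (\<Sum>i=2..5. (class_size n i choose 2) * l i)
      in 2 ^ (\<Sum>i=2..5. l i)
         * (fact n / (fact (n - m) * (\<Prod>i=2..5. fact (class_size n i) ^ l i * fact (l i))))
         * 2 powr (- real b))"

definition D :: "nat \<Rightarrow> (nat \<Rightarrow> nat) \<Rightarrow> (nat \<Rightarrow> nat) \<Rightarrow> real" where
  "D n k l = (\<Prod>i=2..5. real (k i choose l i) ^ 2) / Y_sgn n l"

end

theory Submission
  imports Defs "HOL-Real_Asymp.Real_Asymp"
begin

text \<open>The maximizer at \<open>k\<close> is the Gibbs point at which \<open>ln (x\<^sub>i d\<^sub>u)\<close>, with \<open>u = \<alpha> - i\<close>, is the affine
  function \<open>p + q u\<close> of the class size. The multiplier \<open>- p\<close>, the price of one more class, is at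
  least \<open>(log\<^sub>2 n)\<^sup>2\<close>, so the 16 extra classes of \<open>k_co\<close> lift the objective from its zero at the root
  and make \<open>Y_sgn\<close> of the whole profile at least \<open>exp ((ln n)\<^sup>2)\<close>.

  The summand at \<open>l = 0\<close> is 1. Let \<open>m\<close> be the number of vertices in the shared classes \<open>l\<close>,
  and \<open>r = k - l\<close>, \<open>M = n - m\<close>. If \<open>m \<le> n / 10\<close>, then \<open>D\<close> is at most a power with exponent \<open>\<Sum>l\<^sub>i\<close> of
  \<open>e \<cdot> max (k\<^sub>i\<^sup>2 d\<^sub>u / (2 n\<^sup>u))\<close>, which is \<open>O (1 / log\<^sub>2 n)\<close> by the choice of \<open>\<alpha>\<^sub>0\<close> and \<open>i \<ge> 2\<close>.
  If \<open>M \<le> n / 50\<close>, then \<open>D\<close> is at most the reciprocal of \<open>Y_sgn\<close> of the whole profile. In between, with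
  \<open>R = \<Sum>r\<^sub>i\<close>, \<open>L = \<Sum>l\<^sub>i\<close> and \<open>K = R + L\<close>, the Gibbs relations give
  \<open>ln D \<le> M ln (M / n) + (n / K) (ln 2 / 2) \<Sum>r\<^sub>i (i - s) + O(K)\<close>, where \<open>s = \<alpha> - n / K\<close> is the mean index.
  The first term is at most \<open>- M m / n\<close>, roughly \<open>- n R L / K\<^sup>2\<close>. The last sum is \<open>R L / K\<close> times the difference
  of the mean indices of \<open>r\<close> and \<open>l\<close>, which is at most 3 minus the proportion of classes of index 3 or 4
  and hence below \<open>2 / ln 2 = 2.885...\<close>; so \<open>ln D\<close> is at most a negative multiple of \<open>n\<close>.\<close>

section \<open>Entropy and factorial estimates\<close>

text \<open>The inequality \<open>ln z \<le> z - 1\<close> at \<open>z = x / y\<close>. Summed over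
  coordinates it becomes the nonnegativity of relative entropy.\<close>

lemma diff_le_mult_ln_div:
  fixes x y :: real
  assumes "x > 0" "y \<ge> 0"
  shows "y - x \<le> y * ln (y / x)"
proof (cases "y = 0")
  case False
  with assms have y: "y > 0" by simp
  have "ln (x / y) \<le> x / y - 1"
    using assms y by (intro ln_le_minus_one) simp
  then have "y * ln (x / y) \<le> y * (x / y - 1)"
    using y by (intro mult_left_mono) auto
  also have "\<dots> = x - y" using y by (simp add: field_simps)
  finally have "y * ln (x / y) \<le> x - y" .
  then show ?thesis using assms y by (simp add: ln_div algebra_simps)
qed (use assms in simp)

lemma diff_less_mult_ln_div:
  fixes x y :: real
  assumes "x > 0" "y \<ge> 0" "y \<noteq> x"
  shows "y - x < y * ln (y / x)"
proof (rule ccontr)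
  assume "\<not> ?thesis"
  then have eq: "y * ln (y / x) = y - x"
    using diff_le_mult_ln_div[OF assms(1,2)] by simp
  then have y: "y > 0" using assms by (cases "y = 0") auto
  have "ln (x / y) = x / y - 1"
    using eq y assms(1) by (simp add: ln_div field_simps)
  then have "x / y = 1"
    using assms(1) y by (intro ln_eq_minus_one) auto
  then show False using y assms by simp
qed

text \<open>A second-order upper bound for the convex function z ln z: by
  \<open>ln (1 + v / x) \<le> v / x\<close>, the excess over the tangent at \<open>x\<close> is at
  most \<open>v\<^sup>2 / x\<close>.\<close>

lemma mult_ln_add_le:
  fixes x v :: real
  assumes "x > 0" "x + v > 0"
  shows "(x + v) * ln (x + v) \<le> x * ln x + v * (1 + ln x) + v\<^sup>2 / x"
proof -
  have "ln ((x + v) / x) \<le> (x + v) / x - 1"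
    using assms by (intro ln_le_minus_one) simp
  then have "(x + v) * ln ((x + v) / x) \<le> (x + v) * ((x + v) / x - 1)"
    using assms by (intro mult_left_mono) auto
  also have "\<dots> = v + v\<^sup>2 / x"
    using assms by (simp add: field_simps power2_eq_square)
  finally show ?thesis
    using assms by (simp add: ln_div algebra_simps)
qed

text \<open>A single term of the exponential series gives n^n / n! \<le> e^n.\<close>

lemma ln_fact_ge: "real n * ln (real n) - real n \<le> ln (fact n)"
proof (cases "n = 0")
  case False
  have "(real n) ^ n / fact n \<le> exp (real n)"
  proof -
    have "(\<Sum>k\<in>{n}. real n ^ k /\<^sub>R fact k) \<le> (\<Sum>k. real n ^ k /\<^sub>R fact k)"
      by (rule sum_le_suminf) (use summable_exp_generic[of "real n"] in auto)
    then show ?thesis by (simp add: exp_def divide_inverse mult.commute)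
  qed
  then have "ln ((real n) ^ n / fact n) \<le> ln (exp (real n))"
    using False by (subst ln_le_cancel_iff) auto
  then show ?thesis using False by (simp add: ln_div ln_realpow)
qed simp

lemma ln_fact_le:
  assumes "n > 0"
  shows "ln (fact n) \<le> real n * ln (real n) - real n + 1 + ln (real n)"
  using assms
proof (induction n rule: nat_induct_non_zero)
  case 1
  then show ?case by simp
next
  case (Suc n)
  have "ln (real n / real (Suc n)) \<le> real n / real (Suc n) - 1"
    using Suc by (intro ln_le_minus_one) simp
  then have "real (Suc n) * ln (real n / real (Suc n)) \<le> real (Suc n) * (real n / real (Suc n) - 1)"
    by (intro mult_left_mono) auto
  also have "\<dots> = -1" by (simp add: field_simps)
  finally have "real (Suc n) * ln (real n) + 1 \<le> real (Suc n) * ln (real (Suc n))"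
    using Suc by (simp add: ln_div algebra_simps)
  moreover have "ln (fact (Suc n)) = ln (real (Suc n)) + ln (fact n)"
    by (simp add: ln_mult)
  ultimately show ?case using Suc.IH by (simp add: algebra_simps)
qed

text \<open>The left side is the product of 1 / (1 - j/n) over j < m. As j/n is at most 1/2, each
  factor is at most exp (2j/n), and these exponents add up to less than m^2 / n when m > 0.\<close>

lemma power_div_fact_le_exp:
  assumes "2 * m \<le> n"
  shows "real n ^ m * fact (n - m) / fact n \<le> exp ((real m)\<^sup>2 / real n)"
  using assms
proof (induction m)
  case 0
  then show ?case by simp
next
  case (Suc m)
  then have n: "m < n" "2 * real m \<le> real n" by auto
  define y where "y = real m / real n"
  have y: "0 \<le> y" "y \<le> 1/2" using n by (auto simp: y_def field_simps)
  have step: "1 / (1 - y) \<le> exp (2 * y)"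
  proof -
    have "1 \<le> (1 - y) * (1 + 2 * y)"
      using mult_left_mono[of "2 * y" 1 y] y by (simp add: algebra_simps)
    also have "\<dots> \<le> (1 - y) * exp (2 * y)"
      using y by (intro mult_left_mono exp_ge_add_one_self) auto
    finally show ?thesis using y by (simp add: field_simps)
  qed
  have fa: "fact (n - m) = real (n - m) * fact (n - Suc m)"
    using n by (metis Suc_diff_Suc fact_Suc of_nat_mult of_nat_Suc of_nat_fact)
  have "real n ^ Suc m * fact (n - Suc m) / fact n
      = (real n ^ m * fact (n - m) / fact n) * (1 / (1 - y))"
  proof -
    have "1 / (1 - y) = real n / real (n - m)"
      using n by (simp add: y_def of_nat_diff field_simps)
    then show ?thesis using n by (simp add: fa del: of_nat_diff)
  qed
  also have "\<dots> \<le> exp ((real m)\<^sup>2 / real n) * exp (2 * y)"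
    using Suc y step by (intro mult_mono) auto
  also have "\<dots> \<le> exp ((real (Suc m))\<^sup>2 / real n)"
    using n by (simp add: y_def flip: exp_add) (simp add: field_simps power2_eq_square)
  finally show ?case .
qed

section \<open>Gibbs points\<close>

lemma atLeastAtMost_2_5: "{2..5} = {2, 3, 4, 5 :: nat}"
  by auto

lemma sum_2_5: "(\<Sum>i=2..5. f i) = f 2 + f 3 + f 4 + (f (5::nat) :: 'a :: comm_monoid_add)"
  by (simp add: atLeastAtMost_2_5 add.assoc)

lemma ball_2_5: "(\<forall>i\<in>{2..5}. R i) \<longleftrightarrow> R 2 \<and> R 3 \<and> R 4 \<and> R (5::nat)"
  by (simp add: atLeastAtMost_2_5)

lemma d_pos: "d u > 0"
  by (simp add: d_def)

lemma d_Suc: "d (Suc u) = 2 ^ u * (real u + 1) * d u"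
  by (simp add: d_def power_add algebra_simps numeral_2_eq_2)

lemma class_size_eq: "alpha n = int a \<Longrightarrow> class_size n i = a - i"
  by (simp add: class_size_def)

text \<open>\<open>p\<close> and \<open>q\<close> are the Lagrange multipliers of the constraints on \<open>\<Sum>x\<^sub>i\<close> and \<open>\<Sum>u\<^sub>i x\<^sub>i\<close>.\<close>

definition gibbs_point :: "nat \<Rightarrow> real \<Rightarrow> (nat \<Rightarrow> real) \<Rightarrow> real \<Rightarrow> real \<Rightarrow> bool" where
  "gibbs_point n k x p q \<longleftrightarrow> x \<in> feasible n k \<and>
     (\<forall>i\<in>{2..5}. x i > 0 \<and> ln (x i * d (class_size n i)) = p + q * real (class_size n i))"

text \<open>The logarithms are affine in the class size, so this linear functional of
  \<open>y\<close> sees only the two constraint sums; in particular it is constant on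
  \<open>feasible n k\<close>.\<close>

lemma gibbs_point_sum:
  assumes "gibbs_point n k x p q"
  shows "(\<Sum>i=2..5. y i * ln (x i * d (class_size n i)))
    = p * (\<Sum>i=2..5. y i) + q * (\<Sum>i=2..5. real (class_size n i) * y i)"
proof -
  have "(\<Sum>i=2..5. y i * ln (x i * d (class_size n i)))
      = (\<Sum>i=2..5. y i * (p + q * real (class_size n i)))"
    using assms by (intro sum.cong) (auto simp: gibbs_point_def)
  then show ?thesis
    by (simp add: sum_distrib_left sum.distrib algebra_simps)
qed

lemma gibbs_point_objective:
  assumes "gibbs_point n k x p q"
  shows "objective n k x = real n * ln (real n) - real n + k - p * k - q * real n"
  using gibbs_point_sum[OF assms, of x] assms
  by (simp add: objective_def gibbs_point_def feasible_def)

text \<open>By \<open>gibbs_point_sum\<close>, the objective at \<open>x\<close> exceeds the one at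
  \<open>y\<close> by exactly the relative entropy \<Sum> y ln (y / x), which is positive unless
  \<open>y = x\<close>.\<close>

lemma gibbs_point_strict_max:
  assumes gp: "gibbs_point n k x p q" and y: "y \<in> feasible n k" "y \<noteq> x"
  shows "objective n k y < objective n k x"
proof -
  have pos: "x i > 0" "y i \<ge> 0" if "i \<in> {2..5}" for i
    using gp y that by (auto simp: gibbs_point_def feasible_def PiE_iff)
  have split: "y i * ln (y i * d (class_size n i))
      = y i * ln (y i / x i) + y i * ln (x i * d (class_size n i))" if "i \<in> {2..5}" for i
  proof (cases "y i = 0")
    case False
    then have "y i > 0" using pos[OF that] by simp
    then show ?thesis using pos[OF that] d_pos[of "class_size n i"]
      by (simp add: ln_mult ln_div algebra_simps)
  qed simp
  have "\<exists>j\<in>{2..5}. y j \<noteq> x j"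
  proof (rule ccontr)
    assume "\<not> ?thesis"
    then have "y = x" using gp y(1) 
      by (intro PiE_ext[of y "{2..5}" "\<lambda>_. {0..}" x]) (auto simp: gibbs_point_def feasible_def)
    with y show False by simp
  qed
  then obtain j where j: "j \<in> {2..5}" "y j \<noteq> x j" by blast
  have "(\<Sum>i=2..5. y i - x i) < (\<Sum>i=2..5. y i * ln (y i / x i))"
  proof (rule sum_strict_mono_ex1)
    show "\<forall>i\<in>{2..5}. y i - x i \<le> y i * ln (y i / x i)"
      using pos diff_le_mult_ln_div by blast
    show "\<exists>i\<in>{2..5}. y i - x i < y i * ln (y i / x i)"
      using j pos diff_less_mult_ln_div by blast
  qed simp
  moreover have "(\<Sum>i=2..5. y i - x i) = 0"
    using gp y by (simp add: gibbs_point_def feasible_def sum_subtractf)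
  moreover have "(\<Sum>i=2..5. y i * ln (y i * d (class_size n i)))
      = (\<Sum>i=2..5. y i * ln (y i / x i)) + (\<Sum>i=2..5. y i * ln (x i * d (class_size n i)))"
    by (simp add: split flip: sum.distrib)
  moreover have "(\<Sum>i=2..5. y i * ln (x i * d (class_size n i)))
      = (\<Sum>i=2..5. x i * ln (x i * d (class_size n i)))"
    using gibbs_point_sum[OF gp, of y] gibbs_point_sum[OF gp, of x] gp y(1)
    by (simp add: gibbs_point_def feasible_def)
  ultimately show ?thesis by (simp add: objective_def)
qed

text \<open>\<open>maximizer\<close> is a Hilbert choice; strictness of the maximum leaves it only
  one candidate.\<close>

lemma gibbs_point_maximizer:
  assumes gp: "gibbs_point n k x p q"
  shows "maximizer n k = x"
  unfolding maximizer_def arg_max_def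
proof (rule some_equality)
  have x: "x \<in> feasible n k" using gp by (simp add: gibbs_point_def)
  show "is_arg_max (objective n k) (\<lambda>x. x \<in> feasible n k) x"
    using gibbs_point_strict_max[OF gp] x unfolding is_arg_max_def by (metis order_less_asym)
  show "y = x" if "is_arg_max (objective n k) (\<lambda>x. x \<in> feasible n k) y" for y
    using gibbs_point_strict_max[OF gp] x that unfolding is_arg_max_def by blast
qed

lemma gibbs_point_L_S4:
  assumes gp: "gibbs_point n k x p q"
  shows "L_S4 n k = objective n k x"
  unfolding L_S4_def
proof (rule Greatest_equality)
  show "objective n k x \<in> objective n k ` feasible n k"
    using gp by (simp add: gibbs_point_def)
  show "v \<le> objective n k x" if "v \<in> objective n k ` feasible n k" for v
    using that gibbs_point_strict_max[OF gp] by (metis imageE order.refl less_imp_le)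
qed

text \<open>Up to scaling, the affine condition on the logarithms leaves one free parameter, the
  ratio \<open>t = x 3 / x 2\<close>; prescribing the mean index then becomes a cubic equation for
  \<open>t\<close>. The window for \<open>a - n / k\<close> covers all phases, and the bounds on
  \<open>t\<close> and on the proportions of \<open>x\<close> are absolute.\<close>

lemma gibbs_point_exists:
  fixes k :: real
  assumes a: "alpha n = int a" "a \<ge> 10" and k: "k > 0"
    and s: "14 / 5 \<le> real a - real n / k" "real a - real n / k \<le> 201 / 50"
  obtains x p q t where "gibbs_point n k x p q" "1/2 \<le> t" "t \<le> 10"
    "q = ln (2 ^ (a - 3) * (real a - 2)) - ln t"
    "\<And>i. i \<in> {2..5} \<Longrightarrow> x i \<ge> k / 25000" "x 3 + x 4 \<ge> k / 5"
proof -
  \<comment> \<open>Ratios of consecutive values of \<open>d\<close>. Their own ratios, collected in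
    \<open>\<kappa>\<close> and \<open>\<mu>\<close>, are close to 1/2 and 1/8 for large
    \<open>a\<close>.\<close>
  define R3 R4 R5 :: real where R: "R3 = 2 ^ (a - 3) * (real a - 2)"
    "R4 = 2 ^ (a - 4) * (real a - 3)" "R5 = 2 ^ (a - 5) * (real a - 4)"
  have Rpos: "R3 > 0" "R4 > 0" "R5 > 0" using a by (auto simp: R)
  have dR: "d (a - 2) = R3 * d (a - 3)" "d (a - 3) = R4 * d (a - 4)" "d (a - 4) = R5 * d (a - 5)"
  proof -
    have "a - 2 = Suc (a - 3)" "a - 3 = Suc (a - 4)" "a - 4 = Suc (a - 5)" using a by auto
    moreover have "real (a - 3) + 1 = real a - 2" "real (a - 4) + 1 = real a - 3"
      "real (a - 5) + 1 = real a - 4" using a by auto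
    ultimately show "d (a - 2) = R3 * d (a - 3)" "d (a - 3) = R4 * d (a - 4)"
      "d (a - 4) = R5 * d (a - 5)" unfolding R by (metis d_Suc)+
  qed
  define \<kappa> \<mu> where "\<kappa> = R4 / R3" and "\<mu> = R4 * R5 / R3\<^sup>2"
  have \<kappa>: "0.4 \<le> \<kappa>" "\<kappa> \<le> 0.5"
  proof -
    have "2 ^ (a - 3) = 2 * (2::real) ^ (a - 4)" using a by (simp flip: power_Suc add: Suc_diff_le)
    then have eq: "\<kappa> = (real a - 3) / (2 * (real a - 2))" by (simp add: \<kappa>_def R)
    show "0.4 \<le> \<kappa>" "\<kappa> \<le> 0.5" unfolding eq using a by (auto simp: field_simps)
  qed
  have \<kappa>': "0.4 \<le> R5 / R4" "R5 / R4 \<le> 0.5"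
  proof -
    have "2 ^ (a - 4) = 2 * (2::real) ^ (a - 5)" using a by (simp flip: power_Suc add: Suc_diff_le)
    then have eq: "R5 / R4 = (real a - 4) / (2 * (real a - 3))" by (simp add: R)
    show "0.4 \<le> R5 / R4" "R5 / R4 \<le> 0.5" unfolding eq using a by (auto simp: field_simps)
  qed
  have lam_eq: "\<mu> = \<kappa> * \<kappa> * (R5 / R4)"
    using Rpos by (simp add: \<mu>_def \<kappa>_def power2_eq_square)
  have lam: "0.064 \<le> \<mu>" "\<mu> \<le> 0.125" "\<mu> \<le> 0.25 * \<kappa>"
  proof -
    have "0.4 * 0.4 \<le> \<kappa> * \<kappa>" using \<kappa> by (intro mult_mono) auto
    then have "0.4 * 0.4 * 0.4 \<le> \<mu>" using \<kappa> \<kappa>' unfolding lam_eq by (intro mult_mono) auto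
    then show "0.064 \<le> \<mu>" by simp
    have "\<kappa> * (R5 / R4) \<le> 0.5 * 0.5" using \<kappa> \<kappa>' Rpos by (intro mult_mono) auto
    then have "\<kappa> * (\<kappa> * (R5 / R4)) \<le> \<kappa> * (0.5 * 0.5)" using \<kappa> by (intro mult_left_mono) auto
    then show "\<mu> \<le> 0.25 * \<kappa>" by (simp add: lam_eq mult.assoc)
    then show "\<mu> \<le> 0.125" using \<kappa> by simp
  qed
  define s where "s = real a - real n / k"
  have s: "14 / 5 \<le> s" "s \<le> 201 / 50" using s by (simp_all add: s_def)
  \<comment> \<open>The unnormalized Gibbs weights are \<open>1, t, \<kappa> t\<^sup>2, \<mu> t\<^sup>3\<close>; at a zero of \<open>G\<close> their mean index is \<open>s\<close>.\<close>
  define G where "G = (\<lambda>t. (2 - s) + (3 - s) * t + (4 - s) * \<kappa> * t\<^sup>2 + (5 - s) * \<mu> * t^3)"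
  \<comment> \<open>For every \<open>s\<close> in the window, the weights with
    \<open>t = 1/2\<close> have mean index at most \<open>s\<close>, and those with
    \<open>t = 10\<close> have mean index at least \<open>s\<close>.\<close>
  have "\<exists>t. 1/2 \<le> t \<and> t \<le> 10 \<and> G t = 0"
  proof (rule IVT')
    define X Y where XY: "X = (4 - s) * \<kappa>" "Y = (5 - s) * \<mu>"
    have "X \<le> 3 / 5" using mult_mono[of "4 - s" "6 / 5" \<kappa> "1 / 2"] s \<kappa> by (simp add: XY)
    moreover have "Y \<le> 11 / 40" using mult_mono[of "5 - s" "11 / 5" \<mu> "1 / 8"] s lam by (simp add: XY)
    moreover have "8 * G (1/2) = 28 - 12 * s + 2 * X + Y"
      unfolding G_def XY by (simp add: power2_eq_square power3_eq_cube) (simp add: field_simps)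
    ultimately show "G (1/2) \<le> 0" using s by linarith
    have "- 1 / 50 * \<kappa> \<le> X" unfolding XY using s \<kappa> by (intro mult_right_mono) auto
    then have "- 1 / 100 \<le> X" using \<kappa> by simp
    moreover have "49 / 50 * (8 / 125) \<le> Y" unfolding XY using s lam by (intro mult_mono) auto
    moreover have "G 10 = 32 - 11 * s + 100 * X + 1000 * Y"
      by (simp add: G_def XY)
    ultimately show "0 \<le> G 10" using s by linarith
    show "continuous_on {1/2..10} G" unfolding G_def by (intro continuous_intros)
  qed simp
  then obtain t where t: "1/2 \<le> t" "t \<le> 10" "G t = 0" by blast
  define W where "W = 1 + t + \<kappa> * t\<^sup>2 + \<mu> * t^3"
  have t2: "0.25 \<le> t\<^sup>2" "t\<^sup>2 \<le> 100" using power_mono[of "1/2" t 2] power_mono[of t 10 2] t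
    by (simp_all add: power2_eq_square)
  have t3: "0.125 \<le> t^3" "t^3 \<le> 1000" using power_mono[of "1/2" t 3] power_mono[of t 10 3] t
    by (simp_all add: power3_eq_cube)
  have b4: "0.1 \<le> \<kappa> * t\<^sup>2" "\<kappa> * t\<^sup>2 \<le> 50"
    using mult_mono[of "0.4" \<kappa> "0.25" "t\<^sup>2"] mult_mono[of \<kappa> "0.5" "t\<^sup>2" 100] t2 \<kappa> by auto
  have b5: "0.008 \<le> \<mu> * t^3" "\<mu> * t^3 \<le> 125"
    using mult_mono[of "0.064" \<mu> "0.125" "t^3"] mult_mono[of \<mu> "0.125" "t^3" 1000] t3 lam t
    by auto
  have b54: "\<mu> * t^3 \<le> 2.5 * (\<kappa> * t\<^sup>2)"
  proof -
    have "\<mu> * t^3 \<le> (0.25 * \<kappa>) * (10 * t\<^sup>2)"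
      using t t2 lam \<kappa> by (intro mult_mono) (auto simp: power3_eq_cube power2_eq_square)
    then show ?thesis by simp
  qed
  have W: "0 < W" "W \<le> 186" using t b4 b5 by (auto simp: W_def)
  define w where "w = (\<lambda>i::nat. if i = 2 then 1 else if i = 3 then t else if i = 4 then \<kappa> * t\<^sup>2 else \<mu> * t^3)"
  have w: "w 2 = 1" "w 3 = t" "w 4 = \<kappa> * t\<^sup>2" "w 5 = \<mu> * t^3" by (simp_all add: w_def)
  define c where "c = k / W"
  have c: "c > 0" "c * W = k" using k W by (auto simp: c_def)
  define x where "x = restrict (\<lambda>i. c * w i) {2..5}"
  define q where "q = ln R3 - ln t"
  define p where "p = ln (x 2 * d (a - 2)) - q * real (a - 2)"
  have xw: "x i = c * w i" if "i \<in> {2..5}" for i using that by (simp add: x_def)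
  have wpos: "\<forall>i\<in>{2..5}. w i > 0" using t b4 b5 by (simp add: ball_2_5 w)
  have xpos: "x i > 0" if "i \<in> {2..5}" for i using wpos that c by (simp add: xw)
  have sumx: "(\<Sum>i=2..5. x i) = k"
  proof -
    have "(\<Sum>i=2..5. x i) = c * W" by (simp add: sum_2_5 xw w W_def algebra_simps)
    then show ?thesis using c by simp
  qed
  have sumi: "(\<Sum>i=2..5. (real i - s) * x i) = 0"
  proof -
    have "(\<Sum>i=2..5. (real i - s) * x i) = c * G t"
      by (simp add: sum_2_5 xw w G_def algebra_simps)
    then show ?thesis using t by simp
  qed
  have suma: "(\<Sum>i=2..5. real (class_size n i) * x i) = real n"
  proof -
    have "(\<Sum>i=2..5. real (class_size n i) * x i) = (\<Sum>i=2..5. (real a - s) * x i - (real i - s) * x i)"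
      using a by (intro sum.cong) (auto simp: class_size_eq of_nat_diff algebra_simps)
    also have "\<dots> = (real a - s) * k" by (simp add: sum_subtractf sumi sumx flip: sum_distrib_left)
    finally show ?thesis using k by (simp add: s_def)
  qed
  have feas: "x \<in> feasible n k"
    using sumx suma xpos by (auto simp: feasible_def x_def less_imp_le)
  have lnd: "ln (x i * d (class_size n i)) = p + q * real (class_size n i)" if "i \<in> {2..5}" for i
  proof -
    \<comment> \<open>The products \<open>w i * d (a - i)\<close> form a geometric sequence in
      \<open>i\<close> with ratio \<open>t / R3\<close>, so their logarithms are affine with slope
      \<open>- q\<close>.\<close>
    have *: "ln (x i * d (a - i)) = ln (x 2 * d (a - 2)) + (real i - 2) * (ln t - ln R3)"
      if "w i * d (a - i) = (t / R3) ^ (i - 2) * d (a - 2)" "i \<in> {2..5}" for i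
    proof -
      have "x i * d (a - i) = (t / R3) ^ (i - 2) * (x 2 * d (a - 2))"
        using that(1) that(2) by (simp add: xw w)
      then show ?thesis using t Rpos xpos[of 2] d_pos[of "a - 2"] that(2)
        by (simp add: ln_mult ln_div ln_realpow of_nat_diff)
    qed
    have "\<forall>i\<in>{2..5}. w i * d (a - i) = (t / R3) ^ (i - 2) * d (a - 2)"
      unfolding ball_2_5 using Rpos d_pos[of "a - 5"]
      by (simp add: w dR \<kappa>_def \<mu>_def field_simps power2_eq_square power3_eq_cube)
    with * that have "ln (x i * d (a - i)) = ln (x 2 * d (a - 2)) + (real i - 2) * (ln t - ln R3)"
      by blast
    then show ?thesis using that a
      by (simp add: class_size_eq p_def q_def of_nat_diff algebra_simps)
  qed
  show ?thesis
  proof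
    show "gibbs_point n k x p q" using feas xpos lnd by (simp add: gibbs_point_def)
    show "1/2 \<le> t" "t \<le> 10" by fact+
    show "q = ln (2 ^ (a - 3) * (real a - 2)) - ln t" by (simp add: q_def R)
    show "x i \<ge> k / 25000" if "i \<in> {2..5}" for i
    proof -
      have "\<forall>i\<in>{2..5}. 0.008 \<le> w i" unfolding ball_2_5 w using t b4 b5 by simp
      then have "k / 186 * 0.008 \<le> k / W * w i" using that W k by (intro mult_mono frac_le) auto
      then show ?thesis using k that by (simp add: xw c_def)
    qed
    \<comment> \<open>The weights of indices 2 and 5 are charged to those of 3 and 4, by
      \<open>1 \<le> 2 * t\<close> and \<open>b54\<close>.\<close>
    have "W / 5 \<le> w 3 + w 4" using t b4 b54 by (simp add: W_def w)
    then have "k / W * (W / 5) \<le> k / W * (w 3 + w 4)" using k W by (intro mult_left_mono) auto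
    then show "x 3 + x 4 \<ge> k / 5" using W by (simp add: xw c_def distrib_left)
  qed
qed

section \<open>The value at the witness profile\<close>

text \<open>The first-order change is \<Sum> v (1 + ln (x d)), which equals \<open>h + p * h\<close>
  because \<open>v\<close> leaves the number of vertices fixed; \<open>small\<close> bounds the
  second-order part.\<close>

lemma gibbs_point_perturb:
  assumes gp: "gibbs_point n k x p q"
    and pos: "\<And>i. i \<in> {2..5} \<Longrightarrow> x i + v i > 0"
    and v: "(\<Sum>i=2..5. v i) = h" "(\<Sum>i=2..5. real (class_size n i) * v i) = 0"
    and small: "(\<Sum>i=2..5. (v i)\<^sup>2 / x i) \<le> 1"
  shows "(\<Sum>i=2..5. (x i + v i) * ln ((x i + v i) * d (class_size n i)))
    \<le> (\<Sum>i=2..5. x i * ln (x i * d (class_size n i))) + h + p * h + 1"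
proof -
  let ?d = "\<lambda>i. d (class_size n i)"
  have "(x i + v i) * ln ((x i + v i) * ?d i)
      \<le> x i * ln (x i * ?d i) + v i + v i * ln (x i * ?d i) + (v i)\<^sup>2 / x i"
    if i: "i \<in> {2..5}" for i
  proof -
    have x: "x i > 0" using gp i by (simp add: gibbs_point_def)
    have "ln ((x i + v i) * ?d i) = ln (x i + v i) + ln (?d i)" "ln (x i * ?d i) = ln (x i) + ln (?d i)"
      using x pos[OF i] d_pos[of "class_size n i"] by (simp_all add: ln_mult)
    then show ?thesis
      unfolding \<open>ln ((x i + v i) * ?d i) = _\<close> using mult_ln_add_le[OF x pos[OF i]]
      by (simp add: algebra_simps)
  qed
  then have "(\<Sum>i=2..5. (x i + v i) * ln ((x i + v i) * ?d i))
      \<le> (\<Sum>i=2..5. x i * ln (x i * ?d i) + v i + v i * ln (x i * ?d i) + (v i)\<^sup>2 / x i)"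
    by (intro sum_mono)
  also have "\<dots> \<le> (\<Sum>i=2..5. x i * ln (x i * ?d i)) + h + p * h + 1"
    using small v gibbs_point_sum[OF gp, of v] by (simp add: sum.distrib)
  finally show ?thesis .
qed

text \<open>The optimum at \<open>r + h\<close> is bounded below by one feasible competitor, the
  Gibbs point at \<open>r\<close> shifted by \<open>v\<close>. The second Gibbs point serves to make
  \<open>L_S4 n (r + h)\<close> an attained maximum.\<close>

lemma L_S4_increment:
  assumes a: "alpha n = int a" "a \<ge> 10"
    and gp: "gibbs_point n r x p q" and xl: "\<And>i. i \<in> {2..5} \<Longrightarrow> x i \<ge> r / 25000"
    and h: "16 \<le> h" "h \<le> 17"
    and big: "r \<ge> 14450000 * (real a)\<^sup>2"
    and gp': "gibbs_point n (r + h) x' p' q'"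
  shows "L_S4 n (r + h) \<ge> L_S4 n r - p * h - 1"
proof -
  \<comment> \<open>adds \<open>h\<close> classes without changing the number of vertices\<close>
  define v where "v = (\<lambda>i::nat. if i = 2 then - (real a - 3) * h else if i = 3 then (real a - 2) * h else 0)"
  have av: "\<bar>v i\<bar> \<le> 17 * real a" for i
  proof -
    have "(real a - 3) * h \<le> real a * 17" "(real a - 2) * h \<le> real a * 17"
      using a h by (auto intro!: mult_mono)
    moreover have "0 \<le> (real a - 3) * h" "0 \<le> (real a - 2) * h" using a h by auto
    ultimately show ?thesis using a h by (auto simp: v_def abs_mult algebra_simps)
  qed
  have a1: "real a \<le> (real a)\<^sup>2" using a by (simp add: power2_eq_square)
  \<comment> \<open>The constant 578 is twice the square of 17, so each of the two nonzero terms
    \<open>(v i)\<^sup>2 / x i\<close> is at most 1/2; 14450000 is 25000 times 578.\<close>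
  have xbig: "x i \<ge> 578 * (real a)\<^sup>2" if "i \<in> {2..5}" for i
    using xl[OF that] big by simp
  have pos: "x i + v i > 0" if "i \<in> {2..5}" for i
    using xbig[OF that] av[of i] a1 a by linarith
  have vs: "(\<Sum>i=2..5. v i) = h"
    by (simp add: sum_2_5 v_def algebra_simps)
  have va: "(\<Sum>i=2..5. real (class_size n i) * v i) = 0"
    using a by (simp add: sum_2_5 v_def class_size_eq of_nat_diff algebra_simps)
  have small: "(v i)\<^sup>2 / x i \<le> (if i = 2 \<or> i = 3 then 1 / 2 else 0)" if "i \<in> {2..5}" for i
  proof (cases "i = 2 \<or> i = 3")
    case True
    have "(v i)\<^sup>2 \<le> (17 * real a)\<^sup>2" using av[of i] by (subst abs_le_square_iff[symmetric]) simp
    also have "\<dots> = 289 * (real a)\<^sup>2" by (simp add: power2_eq_square)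
    also have "\<dots> \<le> x i / 2" using xbig[OF that] by simp
    finally have "(v i)\<^sup>2 \<le> x i / 2" .
    moreover have "x i > 0" using gp that by (simp add: gibbs_point_def)
    ultimately show ?thesis using True by (simp add: field_simps)
  qed (simp add: v_def)
  have "(\<Sum>i=2..5. (v i)\<^sup>2 / x i) \<le> (\<Sum>i::nat=2..5. if i = 2 \<or> i = 3 then 1 / 2 else 0)"
    by (intro sum_mono small)
  then have sm: "(\<Sum>i=2..5. (v i)\<^sup>2 / x i) \<le> 1" by (simp add: sum_2_5)
  define y where "y = restrict (\<lambda>i. x i + v i) {2..5}"
  have sums: "(\<Sum>i=2..5. x i) = r" "(\<Sum>i=2..5. real (class_size n i) * x i) = real n"
    using gp by (auto simp: gibbs_point_def feasible_def)
  have yf: "y \<in> feasible n (r + h)"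
    using pos sums vs va by (auto simp: feasible_def y_def sum.distrib distrib_left less_imp_le)
  have "objective n (r + h) y \<le> L_S4 n (r + h)"
    using gibbs_point_strict_max[OF gp' yf] gibbs_point_L_S4[OF gp'] by fastforce
  moreover have "objective n (r + h) y \<ge> objective n r x - p * h - 1"
    using gibbs_point_perturb[OF gp pos vs va sm] by (simp add: objective_def y_def)
  ultimately show ?thesis using gibbs_point_L_S4[OF gp] by simp
qed

lemma ln_d: "ln (d u) = real (u choose 2) * ln 2 + ln (fact u)"
  by (simp add: d_def ln_mult ln_realpow)

lemma real_choose_2: "real (u choose 2) = real u * (real u - 1) / 2"
  by (cases u) (auto simp: choose_two of_nat_diff real_of_nat_div field_simps)

lemma ln_fact_le_mult_ln: "ln (fact u) \<le> real u * ln (real u)"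
proof (cases "u = 0")
  case False
  have "(fact u :: real) \<le> real u ^ u" using fact_le_power[of u, where 'a = real] by simp
  then have "ln (fact u) \<le> ln (real u ^ u)" using False by (subst ln_le_cancel_iff) auto
  then show ?thesis using False by (simp add: ln_realpow)
qed simp

text \<open>The relation at index 2 expresses \<open>p\<close> by \<open>x 2\<close>,
  \<open>d (a - 2)\<close> and \<open>q\<close>. The main part of \<open>ln (d u)\<close> is
  quadratic in \<open>u\<close> and \<open>q\<close> is nearly its slope, so
  \<open>q * (a - 2)\<close> is about twice that main part and one copy of it survives.\<close>

lemma gibbs_point_multiplier_le:
  assumes a: "alpha n = int a" "a \<ge> 10" and n: "n > 0"
    and gp: "gibbs_point n k x p q" and q: "q = ln (2 ^ (a - 3) * (real a - 2)) - ln t"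
    and t: "0 < t" "t \<le> 10"
  shows "- p \<ge> (real a - 2) * (real a - 3) / 2 * ln 2 - (real a - 2) * ln 10 - ln (real n)"
proof -
  have x: "x i > 0" if "i \<in> {2..5}" for i using gp that by (simp add: gibbs_point_def)
  have "x 2 \<le> real (class_size n 2) * x 2" using a x[of 2] by (simp add: class_size_eq)
  also have "\<dots> \<le> (\<Sum>i=2..5. real (class_size n i) * x i)"
    using x by (intro member_le_sum) (auto simp: less_imp_le)
  also have "\<dots> = real n" using gp by (simp add: gibbs_point_def feasible_def)
  finally have "ln (x 2) \<le> ln (real n)" using x[of 2] by simp
  moreover have "ln (x 2 * d (a - 2)) = p + q * real (a - 2)"
    using gp a by (auto simp: gibbs_point_def class_size_eq)
  then have "p = ln (x 2) + ln (d (a - 2)) - q * (real a - 2)"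
    using x[of 2] d_pos[of "a - 2"] a by (simp add: ln_mult of_nat_diff)
  moreover have "ln (d (a - 2)) \<le> (real a - 2) * (real a - 3) / 2 * ln 2 + (real a - 2) * ln (real a - 2)"
    using ln_fact_le_mult_ln[of "a - 2"] a by (simp add: ln_d real_choose_2 of_nat_diff)
  moreover have "q \<ge> (real a - 3) * ln 2 + ln (real a - 2) - ln 10"
    using q t a by (simp add: ln_mult ln_realpow of_nat_diff)
  then have "q * (real a - 2) \<ge> ((real a - 3) * ln 2 + ln (real a - 2) - ln 10) * (real a - 2)"
    using a by (intro mult_right_mono) auto
  ultimately show ?thesis by (simp add: field_simps)
qed

lemma ln_Y_sgn_total:
  assumes "(\<Sum>i=2..5. class_size n i * kk i) = n"
  shows "ln (Y_sgn n kk) = ln (fact n)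
    + (\<Sum>i=2..5. real (kk i) * (ln 2 - ln (d (class_size n i))) - ln (fact (kk i)))"
proof -
  let ?u = "class_size n"
  have "ln (\<Prod>i=2..5. fact (?u i) ^ kk i * (fact (kk i) :: real))
      = (\<Sum>i=2..5. real (kk i) * ln (fact (?u i)) + ln (fact (kk i)))"
    by (subst ln_prod) (auto simp: ln_mult ln_realpow)
  then show ?thesis using assms
    by (simp add: Y_sgn_def Let_def ln_mult ln_div ln_realpow prod_pos ln_powr ln_d
        sum.distrib sum_subtractf sum_distrib_left sum_distrib_right algebra_simps)
qed

lemma Y_sgn_pos: "Y_sgn n l > 0"
  by (auto simp: Y_sgn_def Let_def intro!: mult_pos_pos divide_pos_pos prod_pos)

text \<open>By Stirling, \<open>ln (Y_sgn n kk)\<close> is the objective at \<open>kk\<close> plus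
  \<open>ln 2 * k\<close>, up to an error \<open>1 + ln n\<close> for each of the four factorials
  \<open>fact (kk i)\<close>. Moving from \<open>x\<close> to \<open>kk\<close> preserves both
  constraints and costs at most 1, since 2916 is four times the square of 27.\<close>

lemma ln_Y_sgn_ge:
  assumes a: "alpha n = int a" "a \<ge> 10"
    and gp: "gibbs_point n k x p q" and x: "\<And>i. i \<in> {2..5} \<Longrightarrow> x i \<ge> 2916"
    and kk: "\<And>i. i \<in> {2..5} \<Longrightarrow> \<bar>real (kk i) - x i\<bar> \<le> 27"
    and sums: "(\<Sum>i=2..5. real (kk i)) = k" "(\<Sum>i=2..5. class_size n i * kk i) = n"
  shows "ln (Y_sgn n kk) \<ge> L_S4 n k + ln 2 * k - 5 - 4 * ln (real n)"
proof -
  let ?u = "class_size n"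
  define v where "v = (\<lambda>i. real (kk i) - x i)"
  have xs: "(\<Sum>i=2..5. x i) = k" "(\<Sum>i=2..5. real (?u i) * x i) = real n"
    using gp by (auto simp: gibbs_point_def feasible_def)
  have sr: "(\<Sum>i=2..5. real (?u i) * real (kk i)) = real n"
    using arg_cong[OF sums(2), of real] by simp
  have pos: "x i + v i > 0" "real (kk i) > 0" if "i \<in> {2..5}" for i
    using x[OF that] kk[OF that] by (auto simp: v_def)
  have "(v i)\<^sup>2 / x i \<le> 1 / 4" if "i \<in> {2..5}" for i
  proof -
    have "(v i)\<^sup>2 \<le> 27\<^sup>2" using kk[OF that] by (subst abs_le_square_iff[symmetric]) (simp add: v_def)
    then show ?thesis using x[OF that] by (simp add: field_simps)
  qed
  then have "(\<Sum>i=2..5. (v i)\<^sup>2 / x i) \<le> (\<Sum>i::nat=2..5. 1 / 4)" by (intro sum_mono)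
  then have sm: "(\<Sum>i=2..5. (v i)\<^sup>2 / x i) \<le> 1" by simp
  have "(\<Sum>i=2..5. v i) = 0" "(\<Sum>i=2..5. real (?u i) * v i) = 0"
    using xs sums sr by (simp_all add: v_def sum_subtractf algebra_simps)
  from gibbs_point_perturb[OF gp pos(1) this sm]
  have F: "(\<Sum>i=2..5. real (kk i) * ln (real (kk i) * d (?u i)))
      \<le> (\<Sum>i=2..5. x i * ln (x i * d (?u i))) + 1" by (simp add: v_def)
  have kn: "ln (real (kk i)) \<le> ln (real n)" if "i \<in> {2..5}" for i
  proof -
    have "kk i \<le> ?u i * kk i" using a that by (auto simp: class_size_eq)
    also have "\<dots> \<le> n" using member_le_sum[of i "{2..5}" "\<lambda>i. ?u i * kk i"] that sums by simp
    finally show ?thesis using pos[OF that] by simp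
  qed
  have "real (kk i) * (ln 2 - ln (d (?u i))) - ln (fact (kk i))
      \<ge> real (kk i) * ln 2 + real (kk i) - real (kk i) * ln (real (kk i) * d (?u i)) - (1 + ln (real n))"
    if "i \<in> {2..5}" for i
    using ln_fact_le[of "kk i"] kn[OF that] pos[OF that] d_pos[of "?u i"]
    by (simp add: ln_mult algebra_simps)
  then have "(\<Sum>i=2..5. real (kk i) * (ln 2 - ln (d (?u i))) - ln (fact (kk i)))
      \<ge> (\<Sum>i=2..5. real (kk i) * ln 2 + real (kk i) - real (kk i) * ln (real (kk i) * d (?u i)) - (1 + ln (real n)))"
    by (intro sum_mono)
  also have "(\<Sum>i=2..5. real (kk i) * ln 2 + real (kk i) - real (kk i) * ln (real (kk i) * d (?u i)) - (1 + ln (real n)))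
      = k * ln 2 + k - (\<Sum>i=2..5. real (kk i) * ln (real (kk i) * d (?u i))) - 4 * (1 + ln (real n))"
    using sums by (simp add: sum.distrib sum_subtractf flip: sum_distrib_right)
  finally show ?thesis
    using F ln_fact_ge[of n] ln_Y_sgn_total[OF sums(2)] gibbs_point_L_S4[OF gp]
    by (simp add: objective_def algebra_simps)
qed

section \<open>Few or almost all shared classes\<close>

text \<open>Each shared class contributes \<open>d u / 2\<close>: the factors u! and 2^(u choose 2)
  form \<open>d u\<close>, and the half comes from the sign factor of \<open>Y_sgn\<close>.\<close>

lemma D_eq:
  "D n k l = (\<Prod>i=2..5. real (k i choose l i) ^ 2 * (d (class_size n i) / 2) ^ l i * fact (l i))
    * (fact (n - (\<Sum>i=2..5. class_size n i * l i)) / fact n)"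
proof -
  let ?u = "class_size n"
  have "2 powr (- real (\<Sum>i=2..5. (?u i choose 2) * l i)) = 1 / (\<Prod>i=2..5. (2 ^ (?u i choose 2)) ^ l i)"
    by (simp add: powr_minus powr_realpow power_sum power_mult divide_inverse del: of_nat_sum)
  then show ?thesis
    by (simp add: D_def Y_sgn_def Let_def d_def power_sum prod.distrib prod_dividef
        power_divide power_mult_distrib)
qed

lemma D_nonneg: "D n k l \<ge> 0"
  by (auto simp: D_eq intro!: mult_nonneg_nonneg prod_nonneg divide_nonneg_nonneg zero_le_power
      d_pos[THEN less_imp_le])

lemma D_0: "(\<And>i. i \<in> {2..5} \<Longrightarrow> l i = 0) \<Longrightarrow> D n k l = 1"
  by (simp add: D_eq)

lemma binomial_le_power_div_fact: "real (k choose l) \<le> real k ^ l / fact l"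
proof -
  have "real ((k choose l) * fact l) \<le> real (k ^ l)"
    by (intro of_nat_mono binomial_fact_pow)
  then show ?thesis by (simp add: field_simps)
qed

text \<open>Falling factorials are replaced by powers of \<open>n\<close> at the price exp (m^2 /
  n), and this price must be absorbed by e^L \<Prod> l!. If \<open>a\<^sup>2 * L \<le> n\<close>,
  the power of e suffices; otherwise \<open>L\<close> is so large that the factorials
  dominate.\<close>

lemma D_le_low:
  fixes \<rho> :: real
  assumes a: "\<And>i. i \<in> {2..5} \<Longrightarrow> class_size n i \<le> a" and n: "n > 0"
    and \<rho>: "\<rho> \<ge> 0" "\<And>i. i \<in> {2..5} \<Longrightarrow>
      (real (k i))\<^sup>2 * (d (class_size n i) / 2) \<le> \<rho> * real n ^ class_size n i"
    and m: "10 * (\<Sum>i=2..5. class_size n i * l i) \<le> n"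
    and big: "4 * (real a)\<^sup>2 * exp (real a / 10) \<le> real n"
  shows "D n k l \<le> (exp 1 * \<rho>) ^ (\<Sum>i=2..5. l i)"
proof -
  let ?u = "class_size n"
  define L where "L = (\<Sum>i=2..5. l i)"
  define m where "m = (\<Sum>i=2..5. ?u i * l i)"
  have "(\<Prod>i=2..5. real (k i choose l i) ^ 2 * (d (?u i) / 2) ^ l i * fact (l i))
      \<le> (\<Prod>i=2..5. (\<rho> * real n ^ ?u i) ^ l i / fact (l i))"
  proof (intro prod_mono conjI)
    fix i :: nat assume i: "i \<in> {2..5}"
    have dp: "d (?u i) / 2 \<ge> 0" using d_pos[of "?u i"] by simp
    then show "0 \<le> real (k i choose l i) ^ 2 * (d (?u i) / 2) ^ l i * fact (l i)" by simp
    have "real (k i choose l i) ^ 2 \<le> (real (k i) ^ l i / fact (l i)) ^ 2"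
      by (intro power_mono binomial_le_power_div_fact) simp
    then have "real (k i choose l i) ^ 2 * (d (?u i) / 2) ^ l i * fact (l i)
        \<le> (real (k i) ^ l i / fact (l i)) ^ 2 * (d (?u i) / 2) ^ l i * fact (l i)"
      using dp by (intro mult_right_mono) auto
    also have "\<dots> = ((real (k i))\<^sup>2 * (d (?u i) / 2)) ^ l i / fact (l i)"
      by (simp add: power_mult_distrib power_divide power2_eq_square mult_ac)
    also have "\<dots> \<le> (\<rho> * real n ^ ?u i) ^ l i / fact (l i)"
      using \<rho>(2)[OF i] dp by (intro divide_right_mono power_mono) auto
    finally show "real (k i choose l i) ^ 2 * (d (?u i) / 2) ^ l i * fact (l i) \<le> \<dots>" .
  qed
  also have "\<dots> = \<rho> ^ L * real n ^ m / (\<Prod>i=2..5. fact (l i))"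
    by (simp add: prod_dividef power_mult_distrib prod.distrib power_sum L_def m_def power_mult)
  finally have "D n k l \<le> (\<rho> ^ L * real n ^ m / (\<Prod>i=2..5. fact (l i))) * (fact (n - m) / fact n)"
    unfolding D_eq m_def[symmetric] by (intro mult_right_mono) auto
  also have "\<dots> = \<rho> ^ L / (\<Prod>i=2..5. fact (l i)) * (real n ^ m * fact (n - m) / fact n)"
    by simp
  also have "\<dots> \<le> \<rho> ^ L / (\<Prod>i=2..5. fact (l i)) * exp ((real m)\<^sup>2 / real n)"
    using m \<rho>(1) by (intro mult_left_mono power_div_fact_le_exp) (auto simp: m_def intro!: divide_nonneg_nonneg prod_nonneg)
  also have "\<dots> = \<rho> ^ L * (exp ((real m)\<^sup>2 / real n) / (\<Prod>i=2..5. fact (l i)))" by simp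
  also have "\<dots> \<le> \<rho> ^ L * exp (real L)"
  proof (rule mult_left_mono)
    have mL: "m \<le> a * L" unfolding m_def L_def sum_distrib_left by (intro sum_mono mult_right_mono a) auto
    then have mL': "real m \<le> real a * real L" by (metis of_nat_le_iff of_nat_mult)
    have f1: "(1::real) \<le> (\<Prod>i=2..5. fact (l i))" by (intro prod_ge_1) (simp add: fact_ge_1)
    show "exp ((real m)\<^sup>2 / real n) / (\<Prod>i=2..5. fact (l i)) \<le> exp (real L)"
    proof (cases "(real a)\<^sup>2 * real L \<le> real n")
      case True
      have "(real m)\<^sup>2 \<le> (real a * real L)\<^sup>2" using mL' by (intro power_mono) auto
      also have "\<dots> = ((real a)\<^sup>2 * real L) * real L" by (simp add: power2_eq_square)
      also have "\<dots> \<le> real n * real L" using True by (intro mult_right_mono) auto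
      finally have "(real m)\<^sup>2 / real n \<le> real L" using n by (simp add: field_simps)
      then have "exp ((real m)\<^sup>2 / real n) / (\<Prod>i=2..5. fact (l i)) \<le> exp (real L) / 1"
        using f1 by (intro frac_le) auto
      then show ?thesis by simp
    next
      case False
      then have aL: "real a > 0" "real L > 0" using n by (auto intro: ccontr)
      \<comment> \<open>Here \<open>L > n / a\<^sup>2\<close>, and \<open>big\<close> turns this
        into \<open>L \<ge> 4 * exp (a / 10)\<close>.\<close>
      have "4 * exp (real a / 10) * (real a)\<^sup>2 \<le> real L * (real a)\<^sup>2" using False big by (simp add: mult_ac)
      then have "exp (real a / 10) \<le> real L / 4" using aL by (simp add: mult_le_cancel_right)
      then have "ln (exp (real a / 10)) \<le> ln (real L / 4)" using aL by (subst ln_le_cancel_iff) auto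
      then have lnL: "real a / 10 \<le> ln (real L / 4)" by simp
      \<comment> \<open>Comparison with the even split \<open>L / 4\<close>, at which the product of
        the four factorials is smallest to leading order.\<close>
      have gibbs: "real l' - real L / 4 \<le> real l' * ln (real l' / (real L / 4))" for l'
        using aL by (intro diff_le_mult_ln_div) auto
      have "real l' - real L / 4 + real l' * ln (real L / 4) \<le> real l' * ln (real l')" for l'
      proof (cases "l' = 0")
        case False
        then have "ln (real l' / (real L / 4)) = ln (real l') - ln (real L / 4)"
          using aL by (subst ln_div) auto
        with gibbs[of l'] show ?thesis by (simp add: right_diff_distrib)
      qed (use aL in simp)
      moreover have "real l' * ln (real l') - real l' \<le> ln (fact l')" for l' by (rule ln_fact_ge)
      ultimately have "real l' * ln (real L / 4) - real L / 4 \<le> ln (fact l')" for l'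
        by (smt (verit))
      then have "(\<Sum>i=2..5. real (l i) * ln (real L / 4) - real L / 4) \<le> (\<Sum>i=2..5. ln (fact (l i)))"
        by (intro sum_mono)
      also have "\<dots> = ln (\<Prod>i=2..5. fact (l i))" by (subst ln_prod) auto
      finally have "real L * ln (real L / 4) - real L \<le> ln (\<Prod>i=2..5. fact (l i))"
        by (simp add: sum_subtractf L_def flip: sum_distrib_right)
      moreover have "real L * (real a / 10) \<le> real L * ln (real L / 4)" using lnL by (intro mult_left_mono) auto
      moreover have "(real m)\<^sup>2 / real n \<le> real m / 10"
      proof -
        have "real m * (10 * real m) \<le> real m * real n" using m unfolding m_def[symmetric] by (intro mult_left_mono) auto
        then show ?thesis using n by (simp add: field_simps power2_eq_square)
      qed
      ultimately have "(real m)\<^sup>2 / real n \<le> real L + ln (\<Prod>i=2..5. fact (l i))"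
        using mL' by (simp add: mult.commute)
      then have "exp ((real m)\<^sup>2 / real n) \<le> exp (real L + ln (\<Prod>i=2..5. fact (l i)))" by simp
      also have "\<dots> = exp (real L) * (\<Prod>i=2..5. fact (l i))" using f1 by (simp add: exp_add)
      finally show ?thesis using f1 by (simp add: field_simps)
    qed
  qed (use \<rho> in auto)
  also have "\<dots> = (exp 1 * \<rho>) ^ L" by (simp add: power_mult_distrib flip: exp_of_nat_mult)
  finally show ?thesis by (simp add: L_def)
qed

section \<open>Counting by the classes that are not shared\<close>

lemma binomial_complement_eq:
  fixes c :: real
  assumes "l \<le> k" "c > 0"
  shows "real (k choose l) ^ 2 * c ^ l * fact l
    = real (k choose l) / fact (k - l) / c ^ (k - l) * (c ^ k * fact k)"
proof -
  have "c ^ k = c ^ l * c ^ (k - l)" using assms by (simp flip: power_add)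
  moreover have "fact k = fact l * fact (k - l) * real (k choose l)"
    using binomial_fact_lemma[OF assms(1)] by (metis of_nat_fact of_nat_mult)
  ultimately show ?thesis using assms by (simp add: power2_eq_square field_simps)
qed

text \<open>The value at \<open>l = k\<close>, which is \<open>1 / Y_sgn n k\<close>, is factored
  out; what remains depends on the unshared classes \<open>k - l\<close> and is easy to bound when
  they are few.\<close>

lemma D_eq_complement:
  assumes l: "\<And>i. i \<in> {2..5} \<Longrightarrow> l i \<le> k i" and n: "(\<Sum>i=2..5. class_size n i * k i) = n"
  shows "D n k l = (\<Prod>i=2..5. real (k i choose l i) / fact (k i - l i) / (d (class_size n i) / 2) ^ (k i - l i))
    * fact (\<Sum>i=2..5. class_size n i * (k i - l i)) / Y_sgn n k"
proof -
  let ?c = "\<lambda>i. d (class_size n i) / 2"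
  have inv: "1 / Y_sgn n k = (\<Prod>i=2..5. ?c i ^ k i * fact (k i)) / fact n"
    using D_eq[of n k k] n by (simp add: D_def)
  have m: "n - (\<Sum>i=2..5. class_size n i * l i) = (\<Sum>i=2..5. class_size n i * (k i - l i))"
  proof -
    have "(\<Sum>i=2..5. class_size n i * k i - class_size n i * l i)
        = (\<Sum>i=2..5. class_size n i * k i) - (\<Sum>i=2..5. class_size n i * l i)"
      using l by (intro sum_subtractf_nat) auto
    then show ?thesis by (simp only: n diff_mult_distrib2)
  qed
  have "D n k l = (\<Prod>i=2..5. real (k i choose l i) / fact (k i - l i) / ?c i ^ (k i - l i) * (?c i ^ k i * fact (k i)))
      * (fact (\<Sum>i=2..5. class_size n i * (k i - l i)) / fact n)"
    unfolding D_eq m using l d_pos by (subst prod.cong[OF refl binomial_complement_eq]) auto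
  also have "\<dots> = (\<Prod>i=2..5. real (k i choose l i) / fact (k i - l i) / ?c i ^ (k i - l i))
      * fact (\<Sum>i=2..5. class_size n i * (k i - l i)) * (1 / Y_sgn n k)"
    unfolding inv prod.distrib by simp
  finally show ?thesis by simp
qed

lemma ln_D_eq:
  assumes l: "\<And>i. i \<in> {2..5} \<Longrightarrow> l i \<le> k i" and n: "(\<Sum>i=2..5. class_size n i * k i) = n"
  shows "ln (D n k l) = (\<Sum>i=2..5. ln (real (k i choose l i)) - ln (fact (k i - l i))
      - real (k i - l i) * (ln (d (class_size n i)) - ln 2))
    + ln (fact (\<Sum>i=2..5. class_size n i * (k i - l i))) - ln (Y_sgn n k)"
    and "D n k l > 0"
proof -
  let ?f = "\<lambda>i. real (k i choose l i) / fact (k i - l i) / (d (class_size n i) / 2) ^ (k i - l i)"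
  have pos: "?f i > 0" if "i \<in> {2..5}" for i
    using l[OF that] d_pos by (auto intro!: divide_pos_pos zero_less_power)
  have nz: "?f i \<noteq> 0" if "i \<in> {2..5}" for i
    using pos[OF that] by (rule less_imp_neq[THEN not_sym])
  have "ln (\<Prod>i=2..5. ?f i) = (\<Sum>i=2..5. ln (?f i))"
    by (rule ln_prod[OF finite_atLeastAtMost nz])
  also have "\<dots> = (\<Sum>i=2..5. ln (real (k i choose l i)) - ln (fact (k i - l i))
      - real (k i - l i) * (ln (d (class_size n i)) - ln 2))"
    proof (intro sum.cong refl)
      fix i :: nat assume "i \<in> {2..5}"
      then have "real (k i choose l i) > 0" "d (class_size n i) / 2 > 0"
        using l[of i] d_pos[of "class_size n i"] by auto
      then have "ln (?f i) = ln (real (k i choose l i)) - ln (fact (k i - l i))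
          - real (k i - l i) * ln (d (class_size n i) / 2)"
        by (subst ln_div, simp, simp, subst ln_div) (simp_all add: ln_realpow)
      then show "ln (?f i) = ln (real (k i choose l i)) - ln (fact (k i - l i))
          - real (k i - l i) * (ln (d (class_size n i)) - ln 2)"
        using d_pos[of "class_size n i"] by (simp add: ln_div)
    qed
  finally have lnf: "ln (\<Prod>i=2..5. ?f i) = (\<Sum>i=2..5. ln (real (k i choose l i)) - ln (fact (k i - l i))
      - real (k i - l i) * (ln (d (class_size n i)) - ln 2))" .
  have "(\<Prod>i=2..5. ?f i) > 0" by (rule prod_pos) (rule pos)
  note P = this
  have eq: "D n k l = (\<Prod>i=2..5. ?f i)
      * fact (\<Sum>i=2..5. class_size n i * (k i - l i)) / Y_sgn n k"
    by (rule D_eq_complement[OF l n])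
  show "D n k l > 0" unfolding eq using P Y_sgn_pos by (intro divide_pos_pos mult_pos_pos) auto
  have "ln (D n k l) = ln (\<Prod>i=2..5. ?f i)
      + ln (fact (\<Sum>i=2..5. class_size n i * (k i - l i))) - ln (Y_sgn n k)"
  proof -
    have "ln (P * F / Y) = ln P + ln F - ln Y" if "P > 0" "F > 0" "Y > 0" for P F Y :: real
      using that by (simp add: ln_mult ln_div)
    from this[OF P fact_gt_zero Y_sgn_pos] show ?thesis unfolding eq .
  qed
  then show "ln (D n k l) = (\<Sum>i=2..5. ln (real (k i choose l i)) - ln (fact (k i - l i))
      - real (k i - l i) * (ln (d (class_size n i)) - ln 2))
    + ln (fact (\<Sum>i=2..5. class_size n i * (k i - l i))) - ln (Y_sgn n k)"
    unfolding lnf .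
qed

text \<open>The hypotheses \<open>u\<close> make \<open>d u\<close> at least 2 n M^u, so each
  unshared class contributes at most 2 n / d_u \<le> M^(-u). Together these factors give M^(-M),
  which cancels M! \<le> M^M.\<close>

lemma D_le_top:
  assumes l: "\<And>i. i \<in> {2..5} \<Longrightarrow> l i \<le> k i" and n: "(\<Sum>i=2..5. class_size n i * k i) = n"
    and u: "\<And>i. i \<in> {2..5} \<Longrightarrow> class_size n i > 0"
      "\<And>i. i \<in> {2..5} \<Longrightarrow> ln (2 * real n) \<le> real (class_size n i) * ln 4"
      "\<And>i. i \<in> {2..5} \<Longrightarrow>
        ln (real n / 50) + 1 + ln 4 \<le> ln (real (class_size n i)) + (real (class_size n i) - 1) / 2 * ln 2"
    and M: "50 * (\<Sum>i=2..5. class_size n i * (k i - l i)) \<le> n"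
  shows "D n k l \<le> 1 / Y_sgn n k"
proof -
  let ?u = "class_size n"
  define M where "M = (\<Sum>i=2..5. ?u i * (k i - l i))"
  have realM: "real M = (\<Sum>i=2..5. real (k i - l i) * real (?u i))"
    by (simp add: M_def mult.commute)
  have "(\<Sum>i=2..5. ln (real (k i choose l i)) - ln (fact (k i - l i)) - real (k i - l i) * (ln (d (?u i)) - ln 2))
      \<le> (\<Sum>i=2..5. - real (k i - l i) * (real (?u i) * ln (real M)))"
  proof (rule sum_mono)
    fix i :: nat assume i: "i \<in> {2..5}"
    define r where "r = k i - l i"
    show "ln (real (k i choose l i)) - ln (fact (k i - l i)) - real (k i - l i) * (ln (d (?u i)) - ln 2)
        \<le> - real (k i - l i) * (real (?u i) * ln (real M))"
    \<comment> \<open>For \<open>r = 0\<close> both sides vanish, even if \<open>M = 0\<close>; a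
      nonzero \<open>r\<close> forces \<open>M > 0\<close>.\<close>
    proof (cases "r = 0")
      case True
      with l[OF i] have "l i = k i" by (simp add: r_def)
      then show ?thesis by simp
    next
      case False
      have "?u i * r \<le> M" unfolding M_def r_def
        using member_le_sum[of i "{2..5}" "\<lambda>i. ?u i * (k i - l i)"] i by simp
      moreover have "r \<le> ?u i * r" using u(1)[OF i] by simp
      ultimately have Mpos: "M > 0" using False by linarith
      have "k i \<le> ?u i * k i" using u(1)[OF i] by simp
      also have "\<dots> \<le> n" using member_le_sum[of i "{2..5}" "\<lambda>i. ?u i * k i"] i n by simp
      finally have kn: "k i \<le> n" .
      have k0: "k i > 0" using False by (simp add: r_def)
      have "k i choose l i = k i choose r" unfolding r_def by (rule binomial_symmetric[OF l[OF i]])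
      then have "real (k i choose l i) \<le> real (k i) ^ r / fact r"
        using binomial_le_power_div_fact by simp
      also have "\<dots> \<le> real n ^ r / 1" using kn by (intro frac_le power_mono) (auto simp: fact_ge_1)
      finally have "ln (real (k i choose l i)) \<le> ln (real n ^ r)"
        using l[OF i] kn k0 by (subst ln_le_cancel_iff) auto
      then have A: "ln (real (k i choose l i)) \<le> real r * ln (real n)" using kn k0 by (simp add: ln_realpow)
      have B: "ln (fact r :: real) \<ge> 0" by (simp add: fact_ge_1)
      have C: "ln (d (?u i)) \<ge> real (?u i) * (real (?u i) - 1) / 2 * ln 2 + real (?u i) * ln (real (?u i)) - real (?u i)"
        using ln_fact_ge[of "?u i"] by (simp add: ln_d real_choose_2)
      have "50 * M \<le> n" using M by (simp add: M_def)
      then have "ln (real M) \<le> ln (real n / 50)" using Mpos by (subst ln_le_cancel_iff) auto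
      then have "real (?u i) * (ln (real M) + 1 + ln 4) \<le> real (?u i) * (ln (real (?u i)) + (real (?u i) - 1) / 2 * ln 2)"
        using u(3)[OF i] by (intro mult_left_mono) auto
      then have "ln (real n) + ln 2 - ln (d (?u i)) + real (?u i) * ln (real M) \<le> 0"
        using C u(2)[OF i] kn k0 by (simp add: algebra_simps ln_mult)
      then have "real r * (ln (real n) + ln 2 - ln (d (?u i)) + real (?u i) * ln (real M)) \<le> 0"
        by (simp add: mult_nonneg_nonpos)
      then have "real r * ln (real n) \<le> real r * (ln (d (?u i)) - ln 2) - real r * (real (?u i) * ln (real M))"
        by (simp add: algebra_simps)
      then show ?thesis using A B unfolding r_def[symmetric] by linarith
    qed
  qed
  also have "\<dots> = - (real M * ln (real M))" by (simp add: realM sum_distrib_right sum_negf mult.assoc)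
  finally have "ln (D n k l) \<le> - ln (Y_sgn n k)"
    using ln_D_eq(1)[OF l n] ln_fact_le_mult_ln[of M] by (simp add: M_def)
  then have "ln (D n k l) \<le> ln (1 / Y_sgn n k)" using Y_sgn_pos[of n k] by (simp add: ln_div)
  then show ?thesis using ln_D_eq(2)[OF l n] Y_sgn_pos[of n k] by (subst (asm) ln_le_cancel_iff) auto
qed

section \<open>The intermediate range\<close>

text \<open>Multiplied by \<open>K\<close>, the left side is R L times the difference of the mean
  indices of \<open>r\<close> and \<open>l\<close>. That difference is at most 3, and every class of
  index 3 or 4 lowers it. The constant 281/100 lies below 2 / ln 2, as the intermediate range
  requires.\<close>

lemma sum_complement_spread:
  fixes r l :: "nat \<Rightarrow> real"
  assumes r: "\<And>i. i \<in> {2..5} \<Longrightarrow> r i \<ge> 0" and l: "\<And>i. i \<in> {2..5} \<Longrightarrow> l i \<ge> 0"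
    and K: "K > 0" "(\<Sum>i=2..5. r i + l i) = K"
    and mid: "r 3 + l 3 + (r 4 + l 4) \<ge> 19 / 100 * K"
    and s: "(\<Sum>i=2..5. real i * (r i + l i)) = s * K"
  shows "(\<Sum>i=2..5. r i * (real i - s)) \<le> 281 / 100 * (\<Sum>i=2..5. r i) * (\<Sum>i=2..5. l i) / K"
proof -
  define R L where RL: "R = (\<Sum>i=2..5. r i)" "L = (\<Sum>i=2..5. l i)"
  have RLK: "R + L = K" using K by (simp add: RL sum.distrib)
  have nn: "r 2 \<ge> 0" "r 3 \<ge> 0" "r 4 \<ge> 0" "r 5 \<ge> 0" "l 2 \<ge> 0" "l 3 \<ge> 0" "l 4 \<ge> 0" "l 5 \<ge> 0"
    using r l by auto
  then have RL0: "R \<ge> 0" "L \<ge> 0" by (auto simp: RL sum_2_5)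
  have upper: "(\<Sum>i=2..5. real i * r i) \<le> 5 * R - (r 3 + r 4)"
    and lower: "(\<Sum>i=2..5. real i * l i) \<ge> 2 * L + (l 3 + l 4)"
    using nn by (auto simp: RL sum_2_5)
  define RI LI where I: "RI = (\<Sum>i=2..5. real i * r i)" "LI = (\<Sum>i=2..5. real i * l i)"
  have sK: "s * K = RI + LI" using s by (simp add: I sum.distrib distrib_left)
  have "(\<Sum>i=2..5. r i * (real i - s)) = RI - R * s"
    by (simp add: I RL sum_2_5 algebra_simps)
  then have "K * (\<Sum>i=2..5. r i * (real i - s)) = K * (RI - R * s)" by simp
  also have "\<dots> = K * RI - R * (s * K)" by (simp add: algebra_simps)
  also have "\<dots> = (R + L) * RI - R * (RI + LI)" by (simp only: RLK sK)
  also have "\<dots> = L * RI - R * LI"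
    by (simp add: algebra_simps)
  also have "\<dots> \<le> L * (5 * R - (r 3 + r 4)) - R * (2 * L + (l 3 + l 4))"
    using upper lower RL0 unfolding I by (intro diff_mono mult_left_mono) auto
  also have "\<dots> = 3 * (R * L) - (L * (r 3 + r 4) + R * (l 3 + l 4))"
    by (simp add: algebra_simps)
  finally have "K * (\<Sum>i=2..5. r i * (real i - s)) \<le> 3 * (R * L) - (L * (r 3 + r 4) + R * (l 3 + l 4))" .
  \<comment> \<open>Both \<open>L\<close> and \<open>R\<close> are at least
    \<open>R * L / K\<close>; with this common weight, the classes of index 3 and 4 in
    \<open>r\<close> and in \<open>l\<close> add up to those of the whole profile.\<close>
  moreover have "19 / 100 * (R * L) \<le> L * (r 3 + r 4) + R * (l 3 + l 4)"
  proof -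
    have "R * L \<le> K * L" "R * L \<le> R * K"
      using RL0 RLK by (auto intro: mult_right_mono mult_left_mono)
    then have "R * L / K \<le> L" "R * L / K \<le> R"
      using K(1) by (simp_all add: pos_divide_le_eq mult.commute)
    then have "R * L / K * (r 3 + r 4) \<le> L * (r 3 + r 4)" "R * L / K * (l 3 + l 4) \<le> R * (l 3 + l 4)"
      using nn by (intro mult_right_mono; simp)+
    moreover have "R * L / K * (19 / 100 * K) \<le> R * L / K * ((r 3 + r 4) + (l 3 + l 4))"
      using mid RL0 K by (intro mult_left_mono) auto
    moreover have "R * L / K * ((r 3 + r 4) + (l 3 + l 4)) = R * L / K * (r 3 + r 4) + R * L / K * (l 3 + l 4)"
      by (rule distrib_left)
    moreover have "R * L / K * (19 / 100 * K) = 19 / 100 * (R * L)" using K by simp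
    ultimately have "19 / 100 * (R * L) \<le> L * (r 3 + r 4) + R * (l 3 + l 4)" by linarith
    then show ?thesis by simp
  qed
  ultimately have "K * (\<Sum>i=2..5. r i * (real i - s)) \<le> 281 / 100 * (R * L)" by simp
  then show ?thesis using K by (simp add: RL[symmetric] field_simps)
qed

text \<open>Two terms of order n R L / K^2 compete: the loss \<open>P\<close> from the factorials
  and the gain from \<open>\<Lambda> * S\<close>. The gain is at most 49/50 of the loss up to O(K),
  and \<open>P\<close> is at least n/500 in this range.\<close>

lemma ln_D_le_mid:
  assumes a: "alpha n = int a" "a \<ge> 10"
    and gp: "gibbs_point n K x p q" and K: "K > 0" "3 * K \<le> real n"
    and q: "\<bar>(q - ln (real n) + 1) - real n / K * (ln 2 / 2)\<bar> \<le> 20"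
    and l: "\<And>i. i \<in> {2..5} \<Longrightarrow> l i \<le> k i"
    and sums: "(\<Sum>i=2..5. real (k i)) = K" "(\<Sum>i=2..5. class_size n i * k i) = n"
    and mid: "real (k 3) + real (k 4) \<ge> 19 / 100 * K"
    and Xi: "L_S4 n K + ln 2 * K \<ge> 0"
      "ln (Y_sgn n k) \<ge> L_S4 n K + ln 2 * K - 5 - 4 * ln (real n)"
    and m: "10 * (\<Sum>i=2..5. class_size n i * l i) \<ge> n"
    and M: "50 * (\<Sum>i=2..5. class_size n i * (k i - l i)) \<ge> n"
  shows "ln (D n k l) \<le> 6 + 5 * ln (real n) + 69 * K - real n / 25000"
proof -
  let ?u = "class_size n"
  define r where "r = (\<lambda>i. k i - l i)"
  define M' m' where "M' = (\<Sum>i=2..5. ?u i * r i)" and "m' = (\<Sum>i=2..5. ?u i * l i)"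
  define R L where "R = (\<Sum>i=2..5. real (r i))" and "L = (\<Sum>i=2..5. real (l i))"
  define s where "s = real a - real n / K"
  define S where "S = (\<Sum>i=2..5. real (r i) * (real i - s))"
  have kr: "real (k i) = real (r i) + real (l i)" if "i \<in> {2..5}" for i
    using l[OF that] by (simp add: r_def)
  have rkl: "r i = k i - l i" for i by (simp add: r_def)
  have RL: "R + L = K" using sums(1) kr by (simp add: R_def L_def sum_2_5)
  have RL0: "R \<ge> 0" "L \<ge> 0" by (auto simp: R_def L_def sum_nonneg)
  have xs: "(\<Sum>i=2..5. x i) = K"
    using gp by (auto simp: gibbs_point_def feasible_def)
  have xpos: "x i > 0" if "i \<in> {2..5}" for i
    using gp that by (auto simp: gibbs_point_def)
  have Mm: "M' + m' = n"
  proof -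
    have "M' + m' = (\<Sum>i=2..5. ?u i * (r i + l i))"
      by (simp add: M'_def m'_def sum.distrib distrib_left)
    also have "\<dots> = (\<Sum>i=2..5. ?u i * k i)" using l by (intro sum.cong) (auto simp: r_def)
    finally show ?thesis using sums by simp
  qed
  have nMm: "real n = real M' + real m'" by (simp flip: Mm of_nat_add)
  have n0: "real n > 0" using K by linarith
  have M50: "real n \<le> 50 * real M'" using M unfolding M'_def r_def by linarith
  have m10: "real n \<le> 10 * real m'" using m unfolding m'_def by linarith
  have Mpos: "real M' > 0" "M' > 0" using M50 n0 by linarith+
  have Mn: "real M' \<le> real n" using Mm by simp
  have si: "(\<Sum>i=2..5. real i * (real (r i) + real (l i))) = s * K"
  proof -
    have "real (\<Sum>i=2..5. ?u i * k i) = (\<Sum>i=2..5. (real a - real i) * real (k i))"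
      using a by (simp add: class_size_eq of_nat_diff)
    also have "\<dots> = real a * K - (\<Sum>i=2..5. real i * real (k i))"
      by (simp add: left_diff_distrib sum_subtractf sums flip: sum_distrib_left)
    finally have "(\<Sum>i=2..5. real i * real (k i)) = real a * K - real n" using sums by simp
    moreover have "s * K = real a * K - real n" using K by (simp add: s_def left_diff_distrib)
    moreover have "(\<Sum>i=2..5. real i * (real (r i) + real (l i))) = (\<Sum>i=2..5. real i * real (k i))"
      using kr by (intro sum.cong) auto
    ultimately show ?thesis by simp
  qed
  have Suse: "S \<le> 281 / 100 * R * L / K"
    unfolding S_def R_def L_def
    by (rule sum_complement_spread) (use K RL si mid kr in \<open>auto simp: R_def L_def sum.distrib\<close>)
  \<comment> \<open>\<open>S\<close> measures how far the unshared classes deviate from carrying the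
    average number of vertices.\<close>
  have MS: "real M' = R * real n / K - S"
  proof -
    have "real M' = (\<Sum>i=2..5. (real a - real i) * real (r i))"
      using a by (simp add: M'_def class_size_eq of_nat_diff)
    also have "\<dots> = R * (real a - s) - S"
      by (simp add: R_def S_def sum_2_5 algebra_simps)
    finally show ?thesis by (simp add: s_def)
  qed
  have s25: "2 \<le> s" "s \<le> 5"
  proof -
    have "2 * real (k i) \<le> real i * (real (r i) + real (l i))"
      "real i * (real (r i) + real (l i)) \<le> 5 * real (k i)" if "i \<in> {2..5}" for i
      unfolding kr[OF that] using that by (intro mult_right_mono; simp)+
    then have "(\<Sum>i=2..5. 2 * real (k i)) \<le> (\<Sum>i=2..5. real i * (real (r i) + real (l i)))"
      "(\<Sum>i=2..5. real i * (real (r i) + real (l i))) \<le> (\<Sum>i=2..5. 5 * real (k i))"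
      by (intro sum_mono; simp)+
    then have "2 * K \<le> s * K" "s * K \<le> 5 * K"
      by (simp_all add: si sums flip: sum_distrib_left)
    then show "2 \<le> s" "s \<le> 5" using K by auto
  qed
  have Sabs: "\<bar>S\<bar> \<le> 3 * K"
  proof -
    have "\<bar>S\<bar> \<le> (\<Sum>i=2..5. \<bar>real (r i) * (real i - s)\<bar>)" unfolding S_def by (rule sum_abs)
    also have "\<dots> \<le> (\<Sum>i=2..5. real (r i) * 3)"
      using s25 by (intro sum_mono) (auto simp: abs_mult intro!: mult_left_mono)
    also have "\<dots> = 3 * R" by (simp add: R_def flip: sum_distrib_right)
    finally show ?thesis using RL RL0 by simp
  qed
  have lnd: "ln (d (?u i)) = p + q * real (?u i) - ln (x i)" if "i \<in> {2..5}" for i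
  proof -
    have "ln (x i * d (?u i)) = ln (x i) + ln (d (?u i))"
      using xpos[OF that] d_pos[of "?u i"] by (simp add: ln_mult)
    then show ?thesis using gp that by (auto simp: gibbs_point_def)
  qed
  \<comment> \<open>The binomial costs at most \<open>2 ^ k i\<close>, and r ln (x / r) \<le> x - r.
    Thus only the terms linear in \<open>p\<close> and \<open>q\<close> remain, with a remainder
    that sums to \<open>3 * K\<close>.\<close>
  have class_le: "ln (real (k i choose l i)) - ln (fact (k i - l i)) - real (k i - l i) * (ln (d (?u i)) - ln 2)
      \<le> 2 * real (k i) + x i - (p * real (r i) + q * real (?u i * r i))" if i: "i \<in> {2..5}" for i
  proof -
    have "real (k i choose l i) \<le> 2 ^ k i"
      by (metis binomial_le_pow2 of_nat_le_iff of_nat_numeral of_nat_power)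
    then have "ln (real (k i choose l i)) \<le> ln (2 ^ k i)" using l[OF i] by (subst ln_le_cancel_iff) auto
    then have A: "ln (real (k i choose l i)) \<le> real (k i) * ln 2" by (simp add: ln_realpow)
    have B: "real (r i) * ln (real (r i)) - real (r i) \<le> ln (fact (r i))" by (rule ln_fact_ge)
    have C: "real (r i) * ln (x i) - real (r i) * ln (real (r i)) \<le> x i - real (r i)"
    proof (cases "r i = 0")
      case False
      then have "ln (real (r i) / x i) = ln (real (r i)) - ln (x i)" using xpos[OF i] by (subst ln_div) auto
      with diff_le_mult_ln_div[of "x i" "real (r i)"] xpos[OF i] show ?thesis
        by (simp add: right_diff_distrib)
    qed (use xpos[OF i] in simp)
    have ln2: "ln (2::real) \<le> 1" using ln_2_less_1 by simp
    have E: "real (k i) * ln 2 \<le> real (k i)" "real (r i) * ln 2 \<le> real (r i)"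
      using ln2 by (auto intro: mult_left_le)
    have "real (r i) \<le> real (k i)" using kr[OF i] by simp
    moreover have "real (r i) * (ln (d (?u i)) - ln 2)
        = p * real (r i) + q * real (?u i * r i) - real (r i) * ln (x i) - real (r i) * ln 2"
      by (simp add: lnd[OF i] algebra_simps)
    ultimately show ?thesis using A B C E unfolding rkl[symmetric] by linarith
  qed
  have "ln (D n k l) = (\<Sum>i=2..5. ln (real (k i choose l i)) - ln (fact (k i - l i))
      - real (k i - l i) * (ln (d (?u i)) - ln 2)) + ln (fact M') - ln (Y_sgn n k)"
    unfolding M'_def rkl by (rule ln_D_eq(1)[OF l sums(2)])
  also have "\<dots> \<le> (\<Sum>i=2..5. 2 * real (k i) + x i - (p * real (r i) + q * real (?u i * r i)))
      + ln (fact M') - ln (Y_sgn n k)"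
    by (intro diff_right_mono add_right_mono sum_mono class_le)
  also have "(\<Sum>i=2..5. 2 * real (k i) + x i - (p * real (r i) + q * real (?u i * r i)))
      = 3 * K - p * R - q * real M'"
    by (simp add: sum.distrib sum_subtractf sums xs R_def M'_def flip: sum_distrib_left)
  finally have D1: "ln (D n k l) \<le> 3 * K - p * R - q * real M' + ln (fact M') - ln (Y_sgn n k)" .
  have "ln (real M') \<le> ln (real n)" using Mpos Mn by simp
  then have D2: "ln (fact M') \<le> real M' * ln (real M') - real M' + 1 + ln (real n)"
    using ln_fact_le[OF Mpos(2)] by linarith
  define \<Xi> where "\<Xi> = L_S4 n K + ln 2 * K"
  have Xi_eq: "\<Xi> = real n * ln (real n) - real n + K - p * K - q * real n + ln 2 * K"
    unfolding \<Xi>_def using gibbs_point_L_S4[OF gp] gibbs_point_objective[OF gp] by simp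
  \<comment> \<open>The multiplier \<open>p\<close> is eliminated through \<open>\<Xi>\<close>. This
    introduces only the fraction \<open>R / K\<close> of \<open>\<Xi> \<ge> 0\<close>, which is
    later cancelled against \<open>ln (Y_sgn n k)\<close>.\<close>
  have D3: "- p * R \<le> \<Xi> + R * real n / K * (q - ln (real n) + 1)"
  proof -
    have "- p * R = R / K * (- p * K)" using K by simp
    also have "- p * K = \<Xi> - K - ln 2 * K + real n * (q - ln (real n) + 1)"
      unfolding Xi_eq by (simp add: algebra_simps)
    also have "R / K * (\<Xi> - K - ln 2 * K + real n * (q - ln (real n) + 1))
        = R / K * \<Xi> - (R + R * ln 2) + R * real n / K * (q - ln (real n) + 1)"
      using K by (simp add: field_simps)
    finally have "- p * R = R / K * \<Xi> - (R + R * ln 2) + R * real n / K * (q - ln (real n) + 1)" .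
    moreover have "R / K * \<Xi> \<le> 1 * \<Xi>"
      using RL RL0 K Xi by (intro mult_right_mono) (auto simp: \<Xi>_def)
    moreover have "R + R * ln 2 \<ge> 0" using RL0 by simp
    ultimately show ?thesis by linarith
  qed
  define \<Lambda> where "\<Lambda> = q - ln (real n) + 1"
  have "ln (D n k l) \<le> 3 * K + 6 + 5 * ln (real n)
      + (real M' * ln (real M') - real M' - q * real M' + R * real n / K * \<Lambda>)"
    using D1 D2 D3 Xi(2) unfolding \<Lambda>_def[symmetric] \<Xi>_def[symmetric] by linarith
  also have "real M' * ln (real M') - real M' - q * real M' + R * real n / K * \<Lambda>
      = real M' * ln (real M' / real n) + \<Lambda> * S"
  proof -
    have RnK: "R * real n / K = real M' + S" using MS by simp
    have lnq: "ln (real M' / real n) = ln (real M') - ln (real n)"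
      using Mpos n0 by (subst ln_div) auto
    show ?thesis unfolding lnq RnK by (simp add: \<Lambda>_def algebra_simps)
  qed
  finally have D4: "ln (D n k l) \<le> 3 * K + 6 + 5 * ln (real n) + real M' * ln (real M' / real n) + \<Lambda> * S"
    by simp
  define P where "P = real M' * real m' / real n"
  have D5: "real M' * ln (real M' / real n) \<le> - P"
  proof -
    have "ln (real M' / real n) \<le> real M' / real n - 1" using Mpos n0 by (intro ln_le_minus_one) auto
    also have "\<dots> = - (real m' / real n)" using n0 nMm by (simp add: field_simps)
    finally have "real M' * ln (real M' / real n) \<le> real M' * (- (real m' / real n))"
      using Mpos by (intro mult_left_mono) auto
    then show ?thesis by (simp add: P_def)
  qed
  have D6: "\<Lambda> * S \<le> real n / K * (ln 2 / 2) * S + 60 * K"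
  proof -
    have "(\<Lambda> - real n / K * (ln 2 / 2)) * S \<le> \<bar>\<Lambda> - real n / K * (ln 2 / 2)\<bar> * \<bar>S\<bar>"
      by (metis abs_ge_self abs_mult)
    also have "\<dots> \<le> 20 * (3 * K)" using q Sabs by (intro mult_mono) (auto simp: \<Lambda>_def)
    finally show ?thesis by (simp add: algebra_simps)
  qed
  \<comment> \<open>Substituting M' = R n / K - S and m' = L n / K + S into \<open>P\<close> gives
    the main term; both corrections are O(K) since \<open>\<bar>S\<bar> \<le> 3 * K\<close>.\<close>
  have P6: "real n * R * L / K\<^sup>2 \<le> P + 6 * K"
  proof -
    have mS: "real m' = L * real n / K + S"
    proof -
      have "real m' = real n - real M'" using Mm by simp
      also have "\<dots> = (K - R) * real n / K + S" using MS K by (simp add: field_simps)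
      also have "K - R = L" using RL by simp
      finally show ?thesis .
    qed
    have eq: "P = real n * R * L / K\<^sup>2 + S * (R - L) / K - S\<^sup>2 / real n"
      unfolding P_def mS MS using n0 K by (simp add: field_simps power2_eq_square)
    have "- (S * (R - L)) \<le> \<bar>S\<bar> * \<bar>R - L\<bar>" by (metis abs_ge_minus_self abs_mult)
    also have "\<dots> \<le> (3 * K) * K" using Sabs RL RL0 by (intro mult_mono) auto
    finally have b1: "- (S * (R - L) / K) \<le> 3 * K" using K by (simp add: field_simps)
    have "S\<^sup>2 \<le> (3 * K)\<^sup>2" using Sabs K by (subst abs_le_square_iff[symmetric]) simp
    then have "S\<^sup>2 \<le> 3 * K * (3 * K)" by (simp add: power2_eq_square)
    also have "\<dots> \<le> 3 * K * real n" using K by (intro mult_left_mono) auto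
    finally have "S\<^sup>2 / real n \<le> 3 * K" using n0 by (simp add: field_simps)
    with b1 show ?thesis unfolding eq by linarith
  qed
  have P0: "P \<ge> real n / 500"
  proof -
    have "(real n / 50) * (real n / 10) \<le> real M' * real m'"
      using M50 m10 by (intro mult_mono) auto
    then show ?thesis using n0 by (simp add: P_def field_simps power2_eq_square)
  qed
  have D7: "real n / K * (ln 2 / 2) * S \<le> 49 / 50 * (P + 6 * K)"
  proof -
    have "real n / K * (ln 2 / 2) * S \<le> real n / K * (ln 2 / 2) * (281 / 100 * R * L / K)"
      using Suse n0 K by (intro mult_left_mono) auto
    also have "\<dots> = (ln 2 / 2 * 281 / 100) * (real n * R * L / K\<^sup>2)" by (simp add: power2_eq_square)
    also have "\<dots> \<le> 49 / 50 * (P + 6 * K)"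
    proof (intro mult_mono P6)
      show "ln 2 / 2 * 281 / 100 \<le> (49 / 50 :: real)" using ln2_le_25_over_36 by simp
    qed (use n0 RL0 in auto)
    finally show ?thesis .
  qed
  \<comment> \<open>The surviving fiftieth of \<open>P\<close> is at least n/25000.\<close>
  define E where "E = real n / K * (ln 2 / 2) * S"
  have "50 * E \<le> 49 * P + 294 * K" using D7 unfolding E_def by simp
  moreover have "real n \<le> 500 * P" using P0 by simp
  moreover have "ln (D n k l) \<le> 6 + 5 * ln (real n) + 63 * K - P + E"
    using D4 D5 D6 unfolding E_def[symmetric] by simp
  ultimately have "25000 * ln (D n k l) \<le> 25000 * (6 + 5 * ln (real n)) + 25000 * (69 * K) - real n"
    using K by argo
  then show ?thesis by simp
qed

section \<open>Uniformity over the phase\<close>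

text \<open>The corrections \<open>e1 - 3 e0\<close> and \<open>2 e0 - e1\<close> sum to
  \<open>- e0\<close> and have index-weighted sum \<open>- e1\<close>, so both constraints are
  restored. Rounding errors of at most 1 give \<open>\<bar>e0\<bar> \<le> 4\<close> and
  \<open>\<bar>e1\<bar> \<le> 14\<close>, so an entry moves by at most 1 + 14 + 12 = 27.\<close>

lemma profile_properties:
  assumes a: "alpha n = int a" "a \<ge> 10"
    and x: "x \<in> feasible n (real_of_int (k_co A n))" "maximizer n (real_of_int (k_co A n)) = x"
    and xl: "\<And>i. i \<in> {2..5} \<Longrightarrow> x i \<ge> 27"
    and kt: "is_rounding A n kt"
  shows "\<And>i. i \<in> {2..5} \<Longrightarrow> \<bar>real (profile A n kt i) - x i\<bar> \<le> 27"
    and "(\<Sum>i=2..5. real (profile A n kt i)) = real_of_int (k_co A n)"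
    and "(\<Sum>i=2..5. class_size n i * profile A n kt i) = n"
proof -
  define K where "K = real_of_int (k_co A n)"
  define \<epsilon> where "\<epsilon> = (\<lambda>i. real_of_int (kt i) - x i)"
  have eps: "\<bar>\<epsilon> 2\<bar> \<le> 1" "\<bar>\<epsilon> 3\<bar> \<le> 1" "\<bar>\<epsilon> 4\<bar> \<le> 1" "\<bar>\<epsilon> 5\<bar> \<le> 1"
    using kt x(2) by (auto simp: is_rounding_def \<epsilon>_def ball_2_5)
  have xs: "x 2 + x 3 + x 4 + x 5 = K"
    "(real a - 2) * x 2 + (real a - 3) * x 3 + (real a - 4) * x 4 + (real a - 5) * x 5 = real n"
    using x(1) a by (auto simp: feasible_def sum_2_5 K_def class_size_eq of_nat_diff)
  have ixs: "2 * x 2 + 3 * x 3 + 4 * x 4 + 5 * x 5 = real a * K - real n"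
    using xs(2) unfolding xs(1)[symmetric] by (simp add: algebra_simps)
  have e0: "real_of_int (e0 A n kt) = \<epsilon> 2 + \<epsilon> 3 + \<epsilon> 4 + \<epsilon> 5"
    using xs(1) by (simp add: e0_def sum_2_5 \<epsilon>_def K_def)
  have e1: "real_of_int (e1 A n kt) = 2 * \<epsilon> 2 + 3 * \<epsilon> 3 + 4 * \<epsilon> 4 + 5 * \<epsilon> 5"
    using ixs a by (simp add: e1_def sum_2_5 \<epsilon>_def K_def)
  define \<kappa> where "\<kappa> = (\<lambda>i. if i = 2 then kt 2 + e1 A n kt - 3 * e0 A n kt
     else if i = 3 then kt 3 + 2 * e0 A n kt - e1 A n kt else kt i)"
  have kap: "\<bar>real_of_int (\<kappa> 2) - x 2\<bar> \<le> 27" "\<bar>real_of_int (\<kappa> 3) - x 3\<bar> \<le> 27"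
    "\<bar>real_of_int (\<kappa> 4) - x 4\<bar> \<le> 27" "\<bar>real_of_int (\<kappa> 5) - x 5\<bar> \<le> 27"
    using eps e0 e1 by (auto simp: \<kappa>_def \<epsilon>_def abs_le_iff)
  moreover have "x 2 \<ge> 27" "x 3 \<ge> 27" "x 4 \<ge> 27" "x 5 \<ge> 27" using xl by auto
  ultimately have nn: "\<kappa> 2 \<ge> 0" "\<kappa> 3 \<ge> 0" "\<kappa> 4 \<ge> 0" "\<kappa> 5 \<ge> 0" by linarith+
  have pk: "int (profile A n kt i) = \<kappa> i" if "\<kappa> i \<ge> 0" for i
    using that by (simp add: profile_def \<kappa>_def)
  then have pr: "real (profile A n kt i) = real_of_int (\<kappa> i)" if "\<kappa> i \<ge> 0" for i
    using that by (metis of_int_of_nat_eq)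
  have "\<forall>i\<in>{2..5}. \<bar>real (profile A n kt i) - x i\<bar> \<le> 27"
    unfolding ball_2_5 using kap pr nn by simp
  then show "\<And>i. i \<in> {2..5} \<Longrightarrow> \<bar>real (profile A n kt i) - x i\<bar> \<le> 27" by blast
  have "(\<Sum>i=2..5. real (profile A n kt i)) = K"
    using nn pr xs(1) e0 e1 by (simp add: sum_2_5) (simp add: \<kappa>_def \<epsilon>_def)
  then show "(\<Sum>i=2..5. real (profile A n kt i)) = real_of_int (k_co A n)" by (simp add: K_def)
  have "real (\<Sum>i=2..5. class_size n i * profile A n kt i)
      = real a * (\<Sum>i=2..5. real (profile A n kt i)) - (\<Sum>i=2..5. real i * real (profile A n kt i))"
  proof -
    have "real (class_size n i) = real a - real i" if "i \<le> 5" for i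
      using a that by (simp add: class_size_eq of_nat_diff)
    then show ?thesis by (simp add: sum_2_5) (simp add: algebra_simps)
  qed
  also have "(\<Sum>i=2..5. real i * real (profile A n kt i)) = real a * K - real n"
    using nn pr ixs e0 e1 by (simp add: sum_2_5) (simp add: \<kappa>_def \<epsilon>_def algebra_simps)
  finally have "real (\<Sum>i=2..5. class_size n i * profile A n kt i) = real n"
    using \<open>(\<Sum>i=2..5. real (profile A n kt i)) = K\<close> by simp
  then show "(\<Sum>i=2..5. class_size n i * profile A n kt i) = n" by (simp only: of_nat_eq_iff)
qed

text \<open>The zero vector contributes exactly 1. The powers of \<open>\<rho>\<close> factor into
  four geometric series, and \<open>\<eta>\<close> is paid at most once for each of the at most
  \<open>(n + 1) ^ 4\<close> vectors.\<close>

lemma sum_D_bound: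
  fixes k :: "nat \<Rightarrow> nat"
  assumes \<rho>: "0 \<le> \<rho>" "\<rho> < 1" and \<eta>: "\<eta> \<ge> 0"
    and k: "\<And>i. i \<in> {2..5} \<Longrightarrow> k i \<le> n"
    and D: "\<And>l. l \<in> (\<Pi>\<^sub>E i\<in>{2..5}. {0..k i}) \<Longrightarrow> D n k l \<le> \<rho> ^ (\<Sum>i=2..5. l i) + \<eta>"
  shows "\<bar>(\<Sum>l\<in>(\<Pi>\<^sub>E i\<in>{2..5}. {0..k i}). D n k l) - 1\<bar>
    \<le> (1 / (1 - \<rho>)) ^ 4 - 1 + real (n + 1) ^ 4 * \<eta>"
proof -
  define B where "B = (\<Pi>\<^sub>E i\<in>{2..5}. {0..k i})"
  define z where "z = restrict (\<lambda>_. 0 :: nat) {2..5 :: nat}"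
  have fin: "finite B" unfolding B_def by (intro finite_PiE) auto
  have z: "z \<in> B" by (auto simp: B_def z_def)
  have split: "(\<Sum>l\<in>B. f l) = f z + (\<Sum>l\<in>B - {z}. f l)" for f :: "(nat \<Rightarrow> nat) \<Rightarrow> real"
    using fin z by (rule sum.remove)
  have "(\<Sum>l\<in>B. D n k l) - 1 = (\<Sum>l\<in>B - {z}. D n k l)"
    by (subst split) (use D_0[of z n k] in \<open>simp add: z_def\<close>)
  moreover have "(\<Sum>l\<in>B - {z}. D n k l) \<ge> 0" by (intro sum_nonneg D_nonneg)
  moreover have "(\<Sum>l\<in>B - {z}. D n k l) \<le> (\<Sum>l\<in>B - {z}. \<rho> ^ (\<Sum>i=2..5. l i) + \<eta>)"
    using D by (intro sum_mono) (auto simp: B_def)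
  moreover have "\<dots> = (\<Sum>l\<in>B. \<rho> ^ (\<Sum>i=2..5. l i)) - 1 + real (card (B - {z})) * \<eta>"
    by (subst split) (simp add: sum.distrib z_def)
  moreover have "(\<Sum>l\<in>B. \<rho> ^ (\<Sum>i=2..5. l i)) \<le> (1 / (1 - \<rho>)) ^ 4"
  proof -
    have "(\<Sum>l\<in>B. \<rho> ^ (\<Sum>i=2..5. l i)) = (\<Prod>i=2..5. \<Sum>j\<in>{0..k i}. \<rho> ^ j)"
      unfolding B_def by (subst prod_sum_PiE) (auto simp: power_sum)
    also have "\<dots> \<le> (\<Prod>i::nat=2..5. 1 / (1 - \<rho>))"
    proof (intro prod_mono conjI)
      fix i :: nat
      show "0 \<le> (\<Sum>j\<in>{0..k i}. \<rho> ^ j)" using \<rho> by (intro sum_nonneg) auto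
      have "(\<Sum>j\<in>{0..k i}. \<rho> ^ j) \<le> (\<Sum>j. \<rho> ^ j)"
        using \<rho> by (intro sum_le_suminf summable_geometric) auto
      then show "(\<Sum>j\<in>{0..k i}. \<rho> ^ j) \<le> 1 / (1 - \<rho>)" using \<rho> by (simp add: suminf_geometric)
    qed
    finally show ?thesis by simp
  qed
  moreover have "real (card (B - {z})) * \<eta> \<le> real (n + 1) ^ 4 * \<eta>"
  proof (rule mult_right_mono[OF _ \<eta>])
    have "card (B - {z}) \<le> card B" using fin by (intro card_mono) auto
    also have "\<dots> = (\<Prod>i=2..5. k i + 1)" unfolding B_def by (subst card_PiE) auto
    also have "\<dots> \<le> (\<Prod>i::nat=2..5. n + 1)" using k by (intro prod_mono) auto
    finally have "card (B - {z}) \<le> (n + 1) ^ 4" by simp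
    then show "real (card (B - {z})) \<le> real (n + 1) ^ 4" by (metis of_nat_le_iff of_nat_power)
  qed
  ultimately show ?thesis unfolding B_def[symmetric] by linarith
qed

section \<open>Inequalities for large n\<close>

lemma alpha0_times_ln2:
  assumes "n > 1"
  shows "alpha0 n * ln 2 = 2 * ln (real n) - 2 * ln (log 2 (real n)) + 2 - ln 2"
proof -
  have *: "log 2 x * ln 2 = ln x" for x :: real by (simp add: log_def)
  have "alpha0 n * ln 2 = 2 * (log 2 (real n) * ln 2) - 2 * (log 2 (log 2 (real n)) * ln 2)
      + 2 * (log 2 (exp 1 / 2) * ln 2) + ln 2"
    unfolding alpha0_def by (simp add: algebra_simps)
  then show ?thesis unfolding * by (simp add: ln_div)
qed

text \<open>Beyond the existence of the root, these supply all thresholds on \<open>n\<close>. They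
  mention \<open>alpha0\<close> but not its floor, so none of them depends on the phase.\<close>

lemma eventually_bounds:
  fixes A :: real
  defines "g \<equiv> \<lambda>n. log 2 (real n)"
  shows "\<forall>\<^sub>F n in sequentially. n > 1"
    "\<forall>\<^sub>F n in sequentially. g n \<ge> 100"
    "\<forall>\<^sub>F n in sequentially. 39 / 20 * g n + 7 \<le> alpha0 n"
    "\<forall>\<^sub>F n in sequentially. alpha0 n \<le> 2 * g n"
    "\<forall>\<^sub>F n in sequentially. A * ln (ln (real n)) / ln (real n) \<le> 1 / 200"
    "\<forall>\<^sub>F n in sequentially. 17 * (2 * g n)\<^sup>2 / real n \<le> 1 / 200"
    "\<forall>\<^sub>F n in sequentially. 14450000 * (2 * g n)\<^sup>2 \<le> real n / (2 * g n)"
    "\<forall>\<^sub>F n in sequentially. 72900000 \<le> real n / (2 * g n)"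
    "\<forall>\<^sub>F n in sequentially. 10 \<le> 4 / 5 * ln (g n)"
    "\<forall>\<^sub>F n in sequentially. 4 * (2 * g n)\<^sup>2 * exp (3 / 10 * ln (real n)) \<le> real n"
    "\<forall>\<^sub>F n in sequentially. 6 + 5 * ln (real n) + 69 * (real n / g n) - real n / 25000 \<le> - real n / 50000"
  unfolding g_def alpha0_def log_def
  subgoal by (rule eventually_gt_at_top)
  subgoal by real_asymp
  subgoal by real_asymp
  subgoal by real_asymp
  subgoal by real_asymp
  subgoal by real_asymp
  subgoal by real_asymp
  subgoal by real_asymp
  subgoal by real_asymp
  subgoal by real_asymp
  subgoal by real_asymp
  done

text \<open>The polynomial factor is harmless because (ln n)^2 outgrows 4 ln n.\<close>

lemma error_tendsto_0:
  "(\<lambda>n. (1 / (1 - exp 1 / log 2 (real n))) ^ 4 - 1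
    + real (n + 1) ^ 4 * (exp (- real n / 50000) + exp (- (ln (real n))\<^sup>2))) \<longlonglongrightarrow> 0"
  unfolding log_def by real_asymp

text \<open>To leading order, \<open>alpha0\<close> makes d_u about n^u 2^(-u), and 2^u is close to
  (n / g)^2, which balances \<open>k\<^sup>2\<close>. The gain \<open>1 / g\<close> comes from the
  next order.\<close>

lemma square_times_d_le:
  fixes n u k :: nat
  defines "g \<equiv> log 2 (real n)"
  assumes n: "n > 1" and g: "g \<ge> 100" "39 / 20 * g + 7 \<le> alpha0 n" "10 \<le> 4 / 5 * ln g"
    and u: "alpha0 n - 6 \<le> real u" "real u \<le> alpha0 n - 2"
    and k: "real k \<le> real n / g"
  shows "(real k)\<^sup>2 * (d u / 2) \<le> 1 / g * real n ^ u"
proof (cases "k = 0")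
  case False
  define lg where "lg = ln g"
  define N where "N = ln (real n)"
  have ln2: "2 / 3 \<le> ln (2::real)" "ln (2::real) \<le> 25 / 36"
    using ln2_ge_two_thirds ln2_le_25_over_36 by auto
  have gln: "g * ln 2 = N" by (simp add: g_def log_def N_def)
  have al: "alpha0 n * ln 2 = 2 * N - 2 * lg + 2 - ln 2"
    using alpha0_times_ln2[OF n] by (simp add: lg_def N_def g_def)
  have u1: "real u \<ge> 39 / 20 * g" using u g by linarith
  moreover from this have "real u > 0" using g(1) by linarith
  ultimately have u0: "real u \<ge> 39 / 20 * g" "real u > 0" by auto
  have N0: "N > 0" "lg > 0" "g > 0" using n g by (auto simp: N_def lg_def)
  have ln2g: "ln (2 * g) = ln 2 + lg" using N0 by (simp add: ln_mult lg_def)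
  have uu: "real u * ln 2 \<le> 2 * N - 2 * lg"
  proof -
    have "real u * ln 2 \<le> (alpha0 n - 2) * ln 2" using u by (intro mult_right_mono) auto
    also have "\<dots> = 2 * N - 2 * lg + 2 - 3 * ln 2" using al by (simp add: algebra_simps)
    finally show ?thesis using ln2 by linarith
  qed
  have ul: "real u * ln 2 \<ge> 2 * N - 2 * lg + 2 - 7 * ln 2"
  proof -
    have "2 * N - 2 * lg + 2 - 7 * ln 2 = (alpha0 n - 6) * ln 2" using al by (simp add: algebra_simps)
    also have "\<dots> \<le> real u * ln 2" using u by (intro mult_right_mono) auto
    finally show ?thesis .
  qed
  have half: "(real u - 1) / 2 * ln 2 \<le> N - lg + 1 - 2 * ln 2"
  proof -
    have "(real u - 1) * ln 2 \<le> (alpha0 n - 3) * ln 2" using u by (intro mult_right_mono) auto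
    also have "\<dots> = 2 * N - 2 * lg + 2 - 4 * ln 2" using al by (simp add: algebra_simps)
    finally show ?thesis by simp
  qed
  \<comment> \<open>The size \<open>u\<close> falls short of \<open>2 * g\<close> by a factor 1 -
    lg/N. Over \<open>u\<close> factors this saves at least 14/5 lg, more than the loss
    \<open>ln u \<le> ln 2 + lg\<close> plus the target lg; \<open>10 \<le> 4 / 5 * ln g\<close>
    covers the constants.\<close>
  have lnu: "ln (real u) - ln (2 * g) \<le> - (lg / N)"
  proof -
    have "real u / (2 * g) = (real u * ln 2) / (2 * N)" by (simp add: gln[symmetric])
    also have "\<dots> \<le> (2 * N - 2 * lg) / (2 * N)" using uu N0 by (intro divide_right_mono) auto
    also have "\<dots> = 1 - lg / N" using N0 by (simp add: field_simps)
    finally have "real u / (2 * g) \<le> 1 - lg / N" .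
    moreover have "ln (real u / (2 * g)) \<le> real u / (2 * g) - 1" using u0 N0 by (intro ln_le_minus_one) auto
    moreover have "ln (real u / (2 * g)) = ln (real u) - ln (2 * g)" using u0 N0 by (subst ln_div) auto
    ultimately show ?thesis by linarith
  qed
  have ulg: "real u * (lg / N) \<ge> 14 / 5 * lg"
  proof -
    have "14 / 5 * N \<le> 39 / 20 * g" using ln2 mult_left_mono[OF ln2(2), of g] N0 by (simp flip: gln)
    then have "14 / 5 * N * (lg / N) \<le> real u * (lg / N)"
      using u0 N0 by (intro mult_right_mono) auto
    then show ?thesis using N0 by simp
  qed
  have "ln (d u) \<le> real u * (real u - 1) / 2 * ln 2 + (real u * ln (real u) - real u + 1 + ln (real u))"
    using ln_fact_le[of u] u0 by (simp add: ln_d real_choose_2)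
  also have "real u * (real u - 1) / 2 * ln 2 = real u * ((real u - 1) / 2 * ln 2)" by simp
  also have "\<dots> \<le> real u * (N - lg + 1 - 2 * ln 2)" using half u0 by (intro mult_left_mono) auto
  finally have "ln (d u) - real u * N \<le> real u * (ln (real u) - ln (2 * g)) - real u * ln 2 + 1 + ln (real u)"
    unfolding ln2g by (simp add: algebra_simps)
  moreover have "real u * (ln (real u) - ln (2 * g)) \<le> real u * (- (lg / N))"
    using lnu u0 by (intro mult_left_mono) auto
  moreover have "ln (real u) \<le> ln 2 + lg"
    using lnu N0 by (simp add: ln2g) (smt (verit) divide_nonneg_nonneg)
  ultimately have A: "ln (d u) - real u * N \<le> - 14 / 5 * lg - (2 * N - 2 * lg + 2 - 7 * ln 2) + 1 + ln 2 + lg"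
    using ulg ul by simp
  have "ln (real k) \<le> ln (real n / g)" using False k by (subst ln_le_cancel_iff) (use n N0 in auto)
  then have B: "ln (real k) \<le> N - lg" using n N0 by (simp add: ln_div N_def lg_def)
  have "ln ((real k)\<^sup>2 * (d u / 2)) = 2 * ln (real k) + ln (d u) - ln 2"
    using False d_pos[of u] by (simp add: ln_mult ln_div ln_realpow)
  also have "\<dots> \<le> real u * N - lg" using A B g(3) ln2 unfolding lg_def[symmetric] by simp
  also have "\<dots> = ln (1 / g * real n ^ u)" using n N0 by (simp add: ln_mult ln_div ln_realpow N_def lg_def)
  finally show ?thesis
    using False d_pos[of u] n N0 by (subst (asm) ln_le_cancel_iff) auto
qed (use g in auto)

text \<open>The phase enters only through \<open>a\<close>, by
  \<open>a \<le> alpha0 n < a + 1\<close>, and every estimate holds throughout this interval; hence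
  the bound depends on \<open>n\<close> alone.\<close>

lemma sum_D_error_bound:
  fixes n :: nat and A :: real
  defines "g \<equiv> log 2 (real n)" and "k \<equiv> co_root A n"
  assumes n: "n > 1" and g: "g \<ge> 100"
    and al: "39 / 20 * g + 7 \<le> alpha0 n" "alpha0 n \<le> 2 * g"
    and window: "A * ln (ln (real n)) / ln (real n) \<le> 1 / 200"
    and big: "17 * (2 * g)\<^sup>2 / real n \<le> 1 / 200"
      "14450000 * (2 * g)\<^sup>2 \<le> real n / (2 * g)" "72900000 \<le> real n / (2 * g)"
      "10 \<le> 4 / 5 * ln g" "4 * (2 * g)\<^sup>2 * exp (3 / 10 * ln (real n)) \<le> real n"
      "6 + 5 * ln (real n) + 69 * (real n / g) - real n / 25000 \<le> - real n / 50000"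
    and root: "is_co_root A n k" and kt: "is_rounding A n kt"
  shows "\<bar>(\<Sum>l\<in>(\<Pi>\<^sub>E i\<in>{2..5}. {0..profile A n kt i}). D n (profile A n kt) l) - 1\<bar>
    \<le> (1 / (1 - exp 1 / g)) ^ 4 - 1 + real (n + 1) ^ 4 * (exp (- real n / 50000) + exp (- (ln (real n))\<^sup>2))"
proof -
  define a where "a = nat (alpha n)"
  define h where "h = real_of_int (k_co A n) - k"
  define K where "K = k + h"
  define N where "N = ln (real n)"
  have ln2: "2 / 3 \<le> ln (2::real)" "ln (2::real) \<le> 25 / 36"
    using ln2_ge_two_thirds ln2_le_25_over_36 by auto
  have n0: "real n > 0" using n by simp
  have fl: "real_of_int (alpha n) \<le> alpha0 n" "alpha0 n < real_of_int (alpha n) + 1"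
    unfolding alpha_def by linarith+
  have "alpha n \<ge> 0" using fl al g by linarith
  then have a: "alpha n = int a" by (simp add: a_def)
  have ab: "real a \<le> alpha0 n" "alpha0 n < real a + 1" using fl a by auto
  have a2: "39 / 20 * g + 6 \<le> real a" "real a \<le> 2 * g" using ab al by linarith+
  have "real a \<ge> 10" using a2 g by linarith
  then have a10: "a \<ge> 10" by simp
  have gln: "g * ln 2 = N" by (simp add: g_def log_def N_def)
  have aln: "alpha0 n * ln 2 = 2 * N - 2 * ln g + 2 - ln 2"
    using alpha0_times_ln2[OF n] by (simp add: N_def g_def)
  have Ng: "N \<le> g" "N > 0" using ln2 g mult_left_mono[of "ln 2" 1 g] gln n by (auto simp: N_def)
  define c where "c = 2 / ln (2::real)"
  have c: "72 / 25 \<le> c" "c \<le> 3" "c * ln 2 = 2" using ln2 by (auto simp: c_def field_simps)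
  have s0: "s0 n = alpha0 n - 1 - c" by (simp add: s0_def c_def)
  have k: "k > 0" "L_S4 n k + ln 2 * k = 0" "\<bar>real n / k - s0 n\<bar> \<le> 1 / 200"
    using root order_trans[OF _ window] by (auto simp: is_co_root_def)
  have h: "16 \<le> h" "h < 17" unfolding h_def k_co_def k_def by linarith+
  have K: "K > 0" "k \<le> K" "K = real_of_int (k_co A n)" using k h by (auto simp: K_def h_def)
  have nk: "real n / k \<ge> 39 / 20 * g" "real n / k \<le> 2 * g"
    using k(3) s0 c al by linarith+
  have kn: "real n / (2 * g) \<le> k" using nk(2) k g by (simp add: field_simps)
  \<comment> \<open>Adding \<open>h < 17\<close> classes changes n / k by at most 17 (n / k)^2 /
    n.\<close>
  have nK: "real n / K \<le> real n / k" "real n / k - real n / K \<le> 1 / 200"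
  proof -
    show "real n / K \<le> real n / k" using K k by (intro divide_left_mono) auto
    have "real n / k - real n / K = real n * (K - k) / (k * K)"
      using k(1) K(1) by (simp add: field_simps)
    also have "K - k = h" by (simp add: K_def)
    finally have "real n / k - real n / K = real n * h / (k * K)" .
    also have "\<dots> \<le> real n * 17 / (k * k)" using h k K by (intro frac_le mult_mono) auto
    also have "\<dots> = 17 * (real n / k)\<^sup>2 / real n" using n0 by (simp add: power2_eq_square)
    also have "\<dots> \<le> 17 * (2 * g)\<^sup>2 / real n"
      using nk(2) k by (intro divide_right_mono mult_left_mono power_mono) auto
    finally show "real n / k - real n / K \<le> 1 / 200" using big(1) by linarith
  qed
  have sK: "\<bar>real n / K - s0 n\<bar> \<le> 1 / 100" using nK k(3) by linarith
  \<comment> \<open>With phase \<delta>, the difference \<open>a - s0 n\<close> is 1 + c - \<delta>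
    and lies between \<open>c\<close> and 1 + c, where \<open>c = 2 / ln 2\<close> is between 2.88
    and 3.\<close>
  have means: "14 / 5 \<le> real a - real n / k" "real a - real n / k \<le> 201 / 50"
    "14 / 5 \<le> real a - real n / K" "real a - real n / K \<le> 201 / 50"
    using k(3) sK ab s0 c by linarith+
  obtain x' p' q' t' where gp': "gibbs_point n k x' p' q'" "1/2 \<le> t'" "t' \<le> 10"
      "q' = ln (2 ^ (a - 3) * (real a - 2)) - ln t'"
      "\<And>i. i \<in> {2..5} \<Longrightarrow> x' i \<ge> k / 25000"
    using gibbs_point_exists[OF a a10 k(1) means(1,2)] by metis
  obtain x p q t where gp: "gibbs_point n K x p q" "1/2 \<le> t" "t \<le> 10"
      "q = ln (2 ^ (a - 3) * (real a - 2)) - ln t"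
      "\<And>i. i \<in> {2..5} \<Longrightarrow> x i \<ge> K / 25000" "x 3 + x 4 \<ge> K / 5"
    using gibbs_point_exists[OF a a10 K(1) means(3,4)] by metis
  have g2: "g * 100 \<le> g\<^sup>2" using g unfolding power2_eq_square by (intro mult_left_mono) auto
  \<comment> \<open>The main term is at least (39/20)^2 / 3 > 1.26 times the square of
    \<open>g\<close>; the surplus absorbs the terms linear in \<open>g\<close> once
    \<open>g \<ge> 100\<close>.\<close>
  have p': "- p' \<ge> g\<^sup>2"
  proof -
    have "(39 / 20 * g) * (39 / 20 * g) \<le> (real a - 2) * (real a - 3)"
      using a2 g by (intro mult_mono) auto
    moreover have "(real a - 2) * (real a - 3) / 2 * (2 / 3) \<le> (real a - 2) * (real a - 3) / 2 * ln 2"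
      using ln2 a10 by (intro mult_left_mono) auto
    moreover have "ln (10::real) \<le> 9" using ln_le_minus_one[of "10::real"] by simp
    then have "(real a - 2) * ln 10 \<le> (2 * g) * 9" using a2 a10 g by (intro mult_mono) auto
    moreover have "- p' \<ge> (real a - 2) * (real a - 3) / 2 * ln 2 - (real a - 2) * ln 10 - ln (real n)"
      using gibbs_point_multiplier_le[OF a a10 _ gp'(1,4) _ gp'(3)] gp'(2) n by simp
    moreover have "(39 / 20 * g) * (39 / 20 * g) = 1521 / 400 * g\<^sup>2" by (simp add: power2_eq_square)
    moreover have "(real a - 2) * (real a - 3) / 2 * (2 / 3) = (real a - 2) * (real a - 3) / 3" by simp
    ultimately show ?thesis using Ng(1) g2 g unfolding N_def[symmetric] by linarith
  qed
  have "14450000 * (real a)\<^sup>2 \<le> 14450000 * (2 * g)\<^sup>2" using a2 by (intro mult_left_mono power_mono) auto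
  then have kbig: "k \<ge> 14450000 * (real a)\<^sup>2" using big(2) kn by linarith
  have Xi: "L_S4 n K + ln 2 * K \<ge> 16 * g\<^sup>2 - 1"
  proof -
    have "L_S4 n K \<ge> L_S4 n k - p' * h - 1"
      unfolding K_def using gp(1) h
      by (intro L_S4_increment[OF a a10 gp'(1) gp'(5) _ _ kbig]) (auto simp: K_def)
    moreover have "0 \<le> - p'" using p' zero_le_power2[of g] by linarith
    then have "g\<^sup>2 * 16 \<le> - p' * h" using p' h by (intro mult_mono) auto
    moreover have "ln 2 * K = ln 2 * k + ln 2 * h" by (simp add: K_def algebra_simps)
    moreover have "ln 2 * h \<ge> 0" using h by simp
    ultimately show ?thesis using k(2) by linarith
  qed
  define kk where "kk = profile A n kt"
  \<comment> \<open>The threshold 72900000 is 25000 times 2916.\<close>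
  have xbig: "x i \<ge> 2916" if "i \<in> {2..5}" for i using gp(5)[OF that] K kn big(3) by linarith
  have xK: "x \<in> feasible n (real_of_int (k_co A n))" "maximizer n (real_of_int (k_co A n)) = x"
    using gp(1) gibbs_point_maximizer[OF gp(1)] K(3) by (auto simp: gibbs_point_def)
  have x27: "x i \<ge> 27" if "i \<in> {2..5}" for i using xbig[OF that] by simp
  have kk: "\<bar>real (kk i) - x i\<bar> \<le> 27" if "i \<in> {2..5}" for i
    unfolding kk_def using that by (intro profile_properties(1)[OF a a10 xK x27 kt])
  have sums: "(\<Sum>i=2..5. real (kk i)) = K" "(\<Sum>i=2..5. class_size n i * kk i) = n"
    unfolding kk_def using profile_properties(2,3)[OF a a10 xK x27 kt] K(3) by auto
  have lnY: "ln (Y_sgn n kk) \<ge> L_S4 n K + ln 2 * K - 5 - 4 * ln (real n)"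
    by (rule ln_Y_sgn_ge[OF a a10 gp(1) xbig kk sums])
  have "N\<^sup>2 \<le> g\<^sup>2" using Ng by (intro power_mono) auto
  then have "N\<^sup>2 \<le> ln (Y_sgn n kk)" using lnY Xi Ng g2 g unfolding N_def[symmetric] by linarith
  then have Y: "1 / Y_sgn n kk \<le> exp (- N\<^sup>2)"
    using Y_sgn_pos[of n kk] ln_ge_iff[of "Y_sgn n kk" "N\<^sup>2"] by (simp add: exp_minus field_simps)
  have us: "real (class_size n i) = real a - real i" if "i \<in> {2..5}" for i
    using a a10 that by (simp add: class_size_eq of_nat_diff)
  have ub: "alpha0 n - 6 \<le> real (class_size n i)" "real (class_size n i) \<le> alpha0 n - 2"
      "39 / 20 * g \<le> real (class_size n i)" "class_size n i > 0" if i: "i \<in> {2..5}" for i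
  proof -
    have "2 \<le> real i" "real i \<le> 5" using i by auto
    then show "alpha0 n - 6 \<le> real (class_size n i)" "real (class_size n i) \<le> alpha0 n - 2"
      "39 / 20 * g \<le> real (class_size n i)"
      using us[OF i] ab al by linarith+
    then have "real (class_size n i) > 0" using g by linarith
    then show "class_size n i > 0" by simp
  qed
  have Kg: "K \<le> real n / g"
  proof -
    have "real n / K \<ge> g" using sK s0 al c g by linarith
    then show ?thesis using K g by (simp add: field_simps)
  qed
  have kkK: "real (kk i) \<le> K" if "i \<in> {2..5}" for i
    unfolding sums(1)[symmetric] using that by (intro member_le_sum) auto
  have kkn: "kk i \<le> n" if "i \<in> {2..5}" for i
  proof -
    have "kk i \<le> class_size n i * kk i" using ub(4)[OF that] by simp
    also have "\<dots> \<le> (\<Sum>i=2..5. class_size n i * kk i)" using that by (intro member_le_sum) auto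
    finally show ?thesis using sums by simp
  qed
  have mid: "real (kk 3) + real (kk 4) \<ge> 19 / 100 * K"
  proof -
    have "\<bar>real (kk 3) - x 3\<bar> \<le> 27" "\<bar>real (kk 4) - x 4\<bar> \<le> 27" using kk by auto
    then have "real (kk 3) + real (kk 4) \<ge> K / 5 - 54" using gp(6) by linarith
    then show ?thesis using K kn big(3) by simp
  qed
  \<comment> \<open>Up to bounded terms, \<open>q\<close> is 2 N - ln g and (n / K) ln 2 is 2 N - 2
    ln g, so all growing terms cancel.\<close>
  have q: "\<bar>(q - ln (real n) + 1) - real n / K * (ln 2 / 2)\<bar> \<le> 20"
  proof -
    have q_eq: "q = (real a - 3) * ln 2 + ln (real a - 2) - ln t"
      using gp(4) a10 by (simp add: ln_mult ln_realpow of_nat_diff)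
    have "real n / K * ln 2 \<le> (s0 n + 1 / 100) * ln 2" "(s0 n - 1 / 100) * ln 2 \<le> real n / K * ln 2"
      using sK[unfolded abs_diff_le_iff] by (intro mult_right_mono; simp)+
    then have 1: "real n / K * ln 2 \<le> 2 * N - 2 * ln g - ln 2 * 2 + ln 2 / 100"
      "2 * N - 2 * ln g - ln 2 * 2 - ln 2 / 100 \<le> real n / K * ln 2"
      using aln c(3) by (simp_all add: s0 algebra_simps)
    have "real a * ln 2 \<le> alpha0 n * ln 2" "(alpha0 n - 1) * ln 2 \<le> real a * ln 2"
      using ab by (intro mult_right_mono; simp)+
    then have 2: "real a * ln 2 \<le> 2 * N - 2 * ln g + 2 - ln 2" "2 * N - 2 * ln g + 2 - 2 * ln 2 \<le> real a * ln 2"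
      using aln by (simp_all add: algebra_simps)
    have "ln (real a - 2) \<le> ln (2 * g)" "ln g \<le> ln (real a - 2)"
      using a2 g by (subst ln_le_cancel_iff; simp)+
    then have 3: "ln (real a - 2) \<le> ln 2 + ln g" "ln g \<le> ln (real a - 2)"
      using g by (auto simp: ln_mult)
    have "ln t \<le> t - 1" using gp(2) by (intro ln_le_minus_one) simp
    moreover have "ln (1 / 2) \<le> ln t" using gp(2) by (subst ln_le_cancel_iff) auto
    then have "- ln 2 \<le> ln t" by (simp add: ln_div)
    ultimately have 4: "- ln 2 \<le> ln t" "ln t \<le> 9" using gp(3) by auto
    define b where "b = real n / K * ln 2"
    define a' where "a' = real a * ln 2"
    have "(q - ln (real n) + 1) - real n / K * (ln 2 / 2)
        = a' - 3 * ln 2 + ln (real a - 2) - ln t - N + 1 - b / 2"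
      by (simp add: q_eq N_def a'_def b_def left_diff_distrib)
    moreover have "\<bar>a' - 3 * ln 2 + ln (real a - 2) - ln t - N + 1 - b / 2\<bar> \<le> 20"
      unfolding abs_le_iff using 1 2 3 4 ln2 unfolding a'_def[symmetric] b_def[symmetric]
      by (intro conjI; argo)
    ultimately show ?thesis by simp
  qed
  have Dl: "D n kk l \<le> (exp 1 / g) ^ (\<Sum>i=2..5. l i) + (exp (- real n / 50000) + exp (- N\<^sup>2))"
    if l: "l \<in> (\<Pi>\<^sub>E i\<in>{2..5}. {0..kk i})" for l
  proof -
    have lk: "l i \<le> kk i" if "i \<in> {2..5}" for i using l that by (auto simp: PiE_iff)
    have pos: "(exp 1 / g) ^ (\<Sum>i=2..5. l i) \<ge> 0" using g by simp
    consider (low) "10 * (\<Sum>i=2..5. class_size n i * l i) \<le> n"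
      | (top) "50 * (\<Sum>i=2..5. class_size n i * (kk i - l i)) \<le> n"
      | (mid) "10 * (\<Sum>i=2..5. class_size n i * l i) \<ge> n"
          "50 * (\<Sum>i=2..5. class_size n i * (kk i - l i)) \<ge> n"
      by linarith
    then show ?thesis
    proof cases
      case low
      \<comment> \<open>This yields \<open>a \<le> 2 * g \<le> 3 * N\<close>, hence exp (a/10) is at
        most n^(3/10).\<close>
      have "g * (2 / 3) \<le> N" unfolding gln[symmetric] using ln2 g by (intro mult_left_mono) auto
      then have "real a / 10 \<le> 3 / 10 * N" using a2 by linarith
      then have "4 * (real a)\<^sup>2 * exp (real a / 10) \<le> 4 * (2 * g)\<^sup>2 * exp (3 / 10 * N)"
        using a2 by (intro mult_mono power_mono) auto
      then have e: "4 * (real a)\<^sup>2 * exp (real a / 10) \<le> real n" using big(5) unfolding N_def by linarith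
      have "D n kk l \<le> (exp 1 * (1 / g)) ^ (\<Sum>i=2..5. l i)"
      proof (rule D_le_low[OF _ _ _ _ low e])
        show "class_size n i \<le> a" for i using a by (simp add: class_size_eq)
        show "(real (kk i))\<^sup>2 * (d (class_size n i) / 2) \<le> 1 / g * real n ^ class_size n i"
          if "i \<in> {2..5}" for i
          unfolding g_def using n g al big(4) ub(1,2)[OF that] kkK[OF that] Kg
          by (intro square_times_d_le) (auto simp: g_def)
      qed (use n g in auto)
      then show ?thesis by (simp add: add_increasing2)
    next
      case top
      have "D n kk l \<le> 1 / Y_sgn n kk"
      proof (rule D_le_top[OF lk sums(2) ub(4) _ _ top])
        fix i :: nat assume i: "i \<in> {2..5}"
        have ln4: "ln (4::real) = 2 * ln 2" using ln_realpow[of "2::real" 2] by simp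
        have "39 / 20 * g * (2 * ln 2) \<le> real (class_size n i) * (2 * ln 2)"
          using ub(3)[OF i] by (intro mult_right_mono) auto
        moreover have "ln (2 * real n) = ln 2 + N" using n by (simp add: ln_mult N_def)
        moreover have "100 * ln 2 \<le> N" unfolding gln[symmetric] using g by (intro mult_right_mono) auto
        ultimately show "ln (2 * real n) \<le> real (class_size n i) * ln 4"
          using gln Ng by (simp add: ln4)
        have "(alpha0 n - 7) * ln 2 \<le> (real (class_size n i) - 1) * ln 2"
          using ub(1)[OF i] by (intro mult_right_mono) auto
        then have "(real (class_size n i) - 1) / 2 * ln 2 \<ge> N - ln g + 1 - 4 * ln 2"
          using aln by (simp add: algebra_simps)
        moreover have "ln (39 / 20) + ln g \<le> ln (real (class_size n i))"
        proof -
          have "ln (39 / 20) + ln g = ln (39 / 20 * g)" using g by (subst ln_mult) auto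
          also have "\<dots> \<le> ln (real (class_size n i))"
            using ub(3)[OF i] g by (subst ln_le_cancel_iff) auto
          finally show ?thesis .
        qed
        moreover have "ln (real n / 50) = N - ln 50" using n by (simp add: ln_div N_def)
        \<comment> \<open>The terms in \<open>N\<close> and \<open>ln g\<close> cancel, leaving 64
          \<le> 50 * 39/20; the cutoff n/50 for this range is small enough for that.\<close>
        moreover have "6 * ln (2::real) \<le> ln 50 + ln (39 / 20)"
        proof -
          have "6 * ln (2::real) = ln (2 ^ 6)" by (subst ln_realpow) auto
          also have "\<dots> \<le> ln (50 * (39 / 20))" by (subst ln_le_cancel_iff) auto
          also have "\<dots> = ln 50 + ln (39 / 20)" by (subst ln_mult) auto
          finally show ?thesis .
        qed
        ultimately show "ln (real n / 50) + 1 + ln 4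
            \<le> ln (real (class_size n i)) + (real (class_size n i) - 1) / 2 * ln 2"
          unfolding ln4 by linarith
      qed
      then show ?thesis using Y pos by (simp add: add_increasing)
    next
      case mid': mid
      have K3: "3 * K \<le> real n"
      proof -
        have "real n / g \<le> real n / 3" using g n0 by (intro divide_left_mono) auto
        then show ?thesis using Kg by linarith
      qed
      have "L_S4 n K + ln 2 * K \<ge> 0" using Xi g2 g by linarith
      then have "ln (D n kk l) \<le> 6 + 5 * ln (real n) + 69 * K - real n / 25000"
        by (intro ln_D_le_mid[OF a a10 gp(1) K(1) K3 q lk sums mid _ lnY mid'])
      also have "\<dots> \<le> - real n / 50000" using big(6) Kg by linarith
      finally have "exp (ln (D n kk l)) \<le> exp (- real n / 50000)" by simp
      moreover have "D n kk l > 0" by (rule ln_D_eq(2)[OF lk sums(2)])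
      ultimately show ?thesis using pos by (simp add: add_increasing add_increasing2)
    qed
  qed
  have "exp 1 / g < 1" using g exp_le by simp
  then show ?thesis
    unfolding kk_def[symmetric] N_def[symmetric]
    using g kkn Dl by (intro sum_D_bound) auto
qed

theorem lemma7p1:
  fixes A :: real
  assumes "admissible_window A"
  shows "\<exists>err :: nat \<Rightarrow> real. err \<longlonglongrightarrow> 0 \<and>
    (\<forall>\<^sub>F n in sequentially. \<forall>kt. is_rounding A n kt \<longrightarrow>
      \<bar>(\<Sum>l\<in>(\<Pi>\<^sub>E i\<in>{2..5}. {0..profile A n kt i}). D n (profile A n kt) l) - 1\<bar> \<le> err n)"
proof (intro exI conjI)
  have "\<forall>\<^sub>F n in sequentially. \<exists>!k. is_co_root A n k"
    using assms by (simp add: admissible_window_def)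
  then show "\<forall>\<^sub>F n in sequentially. \<forall>kt. is_rounding A n kt \<longrightarrow>
      \<bar>(\<Sum>l\<in>(\<Pi>\<^sub>E i\<in>{2..5}. {0..profile A n kt i}). D n (profile A n kt) l) - 1\<bar>
      \<le> (1 / (1 - exp 1 / log 2 (real n))) ^ 4 - 1
        + real (n + 1) ^ 4 * (exp (- real n / 50000) + exp (- (ln (real n))\<^sup>2))"
    using eventually_bounds(1-4) eventually_bounds(5)[of A] eventually_bounds(6-11)
  proof eventually_elim
    case (elim n)
    \<comment> \<open>Unique existence justifies the definite description in
      \<open>co_root\<close>.\<close>
    from elim(1) have "is_co_root A n (co_root A n)"
      unfolding co_root_def by (rule theI')
    with elim show ?case by (intro allI impI sum_D_error_bound)
  qed
qed (rule error_tendsto_0)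

end
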